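(* Let $X$ be a coherent $T_0$-space satisfying at least one of the following conditions: (1) $X$ is a core-compact (especially, locally compact) well-filtered space; (2) $X$ is a second-countable well-filtered space; (3) $X$ is a well-filtered space and $P_S(X)$ is first-countable; (4) $X$ is a first-countable well-filtered space and $\min(K)$ is countable for every $K\in Q(X)$; (5) $X$ is a first-countable well-filtered space in which all compact subsets are countable; (6) $X$ is a countable, first-countable and well-filtered space. Then $P_S(X)=P_\sigma(X)$, and $P_S(X)$ is both a sober space and a strong $R$-space. Hence $P_S(X)$ is strongly well-filtered.
   Context: For a $T_0$-space $X$: the specialization order is $x\le_X y\iff x\in\overline{\{y\}}$; a subset is saturated if it equals the intersection of all open sets containing it; $Q(X)$ is the set of all nonempty compact saturated subsets of $X$ (compactness is the open-cover property), ordered by the Smyth order $K_1\sqsubseteq K_2\iff K_2\subseteq K_1$; $\min(K)$ is the set of minimal elements of $K$ in the specialization order. A family $\mathcal K\subseteq Q(X)$ is filtered if it is nonempty and any two members contain a common member of $\mathcal K$. A $T_0$-space $X$ is: well-filtered if for every filtered $\mathcal K\subseteq Q(X)$ and open $U$, $\bigcap\mathcal K\subseteq U$ implies $K\subseteq U$ for some $K\in\mathcal K$; coherent if the intersection of any two compact saturated sets is compact; strongly well-filtered if for every filtered family $\{K_d: d\in D\}\subseteq Q(X)$, $K\in Q(X)$ and open $U$, $\bigcap_{d\in D}K_d\cap K\subseteq U$ implies $K_d\cap K\subseteq U$ for some $d\in D$; a strong $R$-space if for every nonempty family $\{K_i: i\in I\}\subseteq Q(X)$ and open $U$, $\bigcap_{i\in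 I}K_i\subseteq U$ implies $\bigcap_{i\in J}K_i\subseteq U$ for some nonempty finite $J\subseteq I$; sober if every irreducible closed subset is the closure of a unique point. $X$ is locally compact if for every $x$ and open $U\ni x$ there is a compact $K$ with $x\in\mathrm{int}\,K\subseteq K\subseteq U$; $X$ is core-compact if its lattice of open sets is a continuous lattice. $P_S(X)$ (Smyth power space) is $Q(X)$ with the upper Vietoris topology, having base $\{\Box U: U\text{ open in }X\}$, $\Box U=\{K\in Q(X):K\subseteq U\}$. $P_\sigma(X)$ (Scott power space) is $Q(X)$ with the Scott topology of the poset $(Q(X),\sqsubseteq)$: a set $\mathcal U$ is Scott open if it is an upper set and, for every directed $\mathcal D$ whose supremum exists, $\bigvee\mathcal D\in\mathcal U$ implies $\mathcal D\cap\mathcal U\ne\emptyset$. $P_S(X)=P_\sigma(X)$ means the two topologies on $Q(X)$ coincide. *)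

theory Defs
  imports "HOL-Analysis.Analysis" "HOL-Algebra.Complete_Lattice"
begin

section \<open>Posets and the Scott topology\<close>

definition directed_in :: "('a, 'b) gorder_scheme \<Rightarrow> 'a set \<Rightarrow> bool" where
  "directed_in L D \<longleftrightarrow> D \<subseteq> carrier L \<and> D \<noteq> {} \<and>
     (\<forall>x\<in>D. \<forall>y\<in>D. \<exists>z\<in>D. x \<sqsubseteq>\<^bsub>L\<^esub> z \<and> y \<sqsubseteq>\<^bsub>L\<^esub> z)"

text \<open>Suprema are expressed by \<^term>\<open>least L s (Upper L D)\<close> ("the supremum of \<open>D\<close> exists
  and is \<open>s\<close>"), since the operator \<^const>\<open>Lattice.sup\<close> is also defined where no supremum exists.\<close>

definition way_below :: "('a, 'b) gorder_scheme \<Rightarrow> 'a \<Rightarrow> 'a \<Rightarrow> bool" where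
  "way_below L x y \<longleftrightarrow> x \<in> carrier L \<and> y \<in> carrier L \<and>
     (\<forall>D s. directed_in L D \<and> least L s (Upper L D) \<and> y \<sqsubseteq>\<^bsub>L\<^esub> s
            \<longrightarrow> (\<exists>d\<in>D. x \<sqsubseteq>\<^bsub>L\<^esub> d))"

definition continuous_lattice :: "('a, 'b) gorder_scheme \<Rightarrow> bool" where
  "continuous_lattice L \<longleftrightarrow> complete_lattice L \<and>
     (\<forall>x\<in>carrier L. directed_in L {y. way_below L y x} \<and>
        least L x (Upper L {y. way_below L y x}))"

definition scott_open :: "('a, 'b) gorder_scheme \<Rightarrow> 'a set \<Rightarrow> bool" where
  "scott_open L U \<longleftrightarrow> U \<subseteq> carrier L \<and>
     (\<forall>x\<in>U. \<forall>y\<in>carrier L. x \<sqsubseteq>\<^bsub>L\<^esub> y \<longrightarrow> y \<in> U) \<and>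
     (\<forall>D s. directed_in L D \<and> least L s (Upper L D) \<and> s \<in> U \<longrightarrow> D \<inter> U \<noteq> {})"

definition scott_topology :: "('a, 'b) gorder_scheme \<Rightarrow> 'a topology" where
  "scott_topology L = topology (scott_open L)"


section \<open>Properties of \<open>T\<^sub>0\<close>-spaces\<close>

definition specialization_le :: "'a topology \<Rightarrow> 'a \<Rightarrow> 'a \<Rightarrow> bool" where
  "specialization_le X x y \<longleftrightarrow> x \<in> X closure_of {y}"

definition saturated_in :: "'a topology \<Rightarrow> 'a set \<Rightarrow> bool" where
  "saturated_in X S \<longleftrightarrow> S \<subseteq> topspace X \<and> S = \<Inter>{U. openin X U \<and> S \<subseteq> U}"

definition Q_sets :: "'a topology \<Rightarrow> 'a set set" where
  "Q_sets X = {K. K \<noteq> {} \<and> compactin X K \<and> saturated_in X K}"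

definition minimal_points :: "'a topology \<Rightarrow> 'a set \<Rightarrow> 'a set" where
  "minimal_points X K = {x\<in>K. \<forall>y\<in>K. specialization_le X y x \<longrightarrow> y = x}"

definition filtered_family :: "'a set set \<Rightarrow> bool" where
  "filtered_family \<K> \<longleftrightarrow> \<K> \<noteq> {} \<and> (\<forall>K1\<in>\<K>. \<forall>K2\<in>\<K>. \<exists>K3\<in>\<K>. K3 \<subseteq> K1 \<inter> K2)"

definition well_filtered_space :: "'a topology \<Rightarrow> bool" where
  "well_filtered_space X \<longleftrightarrow> t0_space X \<and>
     (\<forall>\<K> U. \<K> \<subseteq> Q_sets X \<and> filtered_family \<K> \<and> openin X U \<and> \<Inter>\<K> \<subseteq> U
            \<longrightarrow> (\<exists>K\<in>\<K>. K \<subseteq> U))"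

definition coherent_space :: "'a topology \<Rightarrow> bool" where
  "coherent_space X \<longleftrightarrow> t0_space X \<and>
     (\<forall>K1 K2. compactin X K1 \<and> saturated_in X K1 \<and> compactin X K2 \<and> saturated_in X K2
            \<longrightarrow> compactin X (K1 \<inter> K2))"

definition strongly_well_filtered_space :: "'a topology \<Rightarrow> bool" where
  "strongly_well_filtered_space X \<longleftrightarrow> t0_space X \<and>
     (\<forall>\<K> K U. \<K> \<subseteq> Q_sets X \<and> filtered_family \<K> \<and> K \<in> Q_sets X \<and> openin X U \<and> \<Inter>\<K> \<inter> K \<subseteq> U
            \<longrightarrow> (\<exists>K'\<in>\<K>. K' \<inter> K \<subseteq> U))"

definition strong_R_space :: "'a topology \<Rightarrow> bool" where
  "strong_R_space X \<longleftrightarrow> t0_space X \<and>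
     (\<forall>\<K> U. \<K> \<subseteq> Q_sets X \<and> \<K> \<noteq> {} \<and> openin X U \<and> \<Inter>\<K> \<subseteq> U
            \<longrightarrow> (\<exists>\<F>. finite \<F> \<and> \<F> \<noteq> {} \<and> \<F> \<subseteq> \<K> \<and> \<Inter>\<F> \<subseteq> U))"

definition irreducible_closed_in :: "'a topology \<Rightarrow> 'a set \<Rightarrow> bool" where
  "irreducible_closed_in X C \<longleftrightarrow> closedin X C \<and> C \<noteq> {} \<and>
     (\<forall>A B. closedin X A \<and> closedin X B \<and> C \<subseteq> A \<union> B \<longrightarrow> C \<subseteq> A \<or> C \<subseteq> B)"

definition sober_space :: "'a topology \<Rightarrow> bool" where
  "sober_space X \<longleftrightarrow> t0_space X \<and>
     (\<forall>C. irreducible_closed_in X C \<longrightarrow> (\<exists>!x. x \<in> topspace X \<and> C = X closure_of {x}))"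

text \<open>The library's \<^const>\<open>locally_compact_space\<close> only asks for one compact neighbourhood
  of each point, which is weaker for non-Hausdorff spaces.\<close>

definition locally_compact_T0 :: "'a topology \<Rightarrow> bool" where
  "locally_compact_T0 X \<longleftrightarrow> t0_space X \<and>
     (\<forall>x U. openin X U \<and> x \<in> U
            \<longrightarrow> (\<exists>K. compactin X K \<and> x \<in> X interior_of K \<and> K \<subseteq> U))"

definition open_set_lattice :: "'a topology \<Rightarrow> 'a set gorder" where
  "open_set_lattice X = \<lparr>carrier = {U. openin X U}, eq = (=), le = (\<subseteq>)\<rparr>"

definition core_compact_space :: "'a topology \<Rightarrow> bool" where
  "core_compact_space X \<longleftrightarrow> t0_space X \<and> continuous_lattice (open_set_lattice X)"


section \<open>Smyth and Scott power spaces\<close>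

definition smyth_order :: "'a topology \<Rightarrow> 'a set gorder" where
  "smyth_order X = \<lparr>carrier = Q_sets X, eq = (=), le = (\<lambda>K1 K2. K2 \<subseteq> K1)\<rparr>"

definition upper_box :: "'a topology \<Rightarrow> 'a set \<Rightarrow> 'a set set" where
  "upper_box X U = {K \<in> Q_sets X. K \<subseteq> U}"

definition smyth_power_space :: "'a topology \<Rightarrow> 'a set topology" where
  "smyth_power_space X = topology (arbitrary union_of (\<lambda>B. \<exists>U. openin X U \<and> B = upper_box X U))"

definition scott_power_space :: "'a topology \<Rightarrow> 'a set topology" where
  "scott_power_space X = scott_topology (smyth_order X)"


section \<open>The two families of open sets are topologies\<close>

lemma openin_smyth_power_space:
  "openin (smyth_power_space X) = arbitrary union_of (\<lambda>B. \<exists>U. openin X U \<and> B = upper_box X U)"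
proof -
  have "istopology (arbitrary union_of (\<lambda>B. \<exists>U. openin X U \<and> B = upper_box X U))"
  proof (rule istopology_base)
    fix S T
    assume "\<exists>U. openin X U \<and> S = upper_box X U" "\<exists>U. openin X U \<and> T = upper_box X U"
    then obtain U V where "openin X U" "S = upper_box X U" "openin X V" "T = upper_box X V" by blast
    then have "openin X (U \<inter> V) \<and> S \<inter> T = upper_box X (U \<inter> V)"
      by (auto simp: upper_box_def)
    then show "\<exists>W. openin X W \<and> S \<inter> T = upper_box X W" by blast
  qed
  then show ?thesis
    by (simp add: smyth_power_space_def topology_inverse')
qed

lemma topspace_smyth_power_space: "topspace (smyth_power_space X) = Q_sets X"
proof -
  have "openin (smyth_power_space X) (upper_box X (topspace X))"
    unfolding openin_smyth_power_space by (rule union_of_inc) (auto simp: arbitrary_def)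
  moreover have "upper_box X (topspace X) = Q_sets X"
    by (auto simp: upper_box_def Q_sets_def saturated_in_def)
  ultimately have "Q_sets X \<subseteq> topspace (smyth_power_space X)"
    using openin_subset by metis
  moreover have "topspace (smyth_power_space X) \<subseteq> Q_sets X"
    unfolding topspace_def openin_smyth_power_space
    by (auto simp: union_of_def upper_box_def)
  ultimately show ?thesis by blast
qed

lemma istopology_scott_open: "istopology (scott_open L)"
  unfolding istopology_def
proof (intro conjI allI impI)
  fix S T assume S: "scott_open L S" and T: "scott_open L T"
  have "D \<inter> (S \<inter> T) \<noteq> {}"
    if D: "directed_in L D" and s: "least L s (Upper L D)" "s \<in> S \<inter> T" for D s
  proof -
    have "D \<inter> S \<noteq> {}" "D \<inter> T \<noteq> {}"
      using S T D s unfolding scott_open_def by blast+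
    then obtain a b where "a \<in> D \<inter> S" "b \<in> D \<inter> T" by blast
    moreover from this D obtain c where "c \<in> D" "a \<sqsubseteq>\<^bsub>L\<^esub> c" "b \<sqsubseteq>\<^bsub>L\<^esub> c"
      unfolding directed_in_def by blast
    moreover have "c \<in> carrier L"
      using D \<open>c \<in> D\<close> unfolding directed_in_def by blast
    ultimately show ?thesis
      using S T unfolding scott_open_def by blast
  qed
  then show "scott_open L (S \<inter> T)"
    using S T unfolding scott_open_def by blast
next
  fix \<U> assume "\<forall>U\<in>\<U>. scott_open L U"
  then have U: "U \<subseteq> carrier L"
    "\<And>x y. x \<in> U \<Longrightarrow> y \<in> carrier L \<Longrightarrow> x \<sqsubseteq>\<^bsub>L\<^esub> y \<Longrightarrow> y \<in> U"
    "\<And>D s. directed_in L D \<Longrightarrow> least L s (Upper L D) \<Longrightarrow> s \<in> U \<Longrightarrow> D \<inter> U \<noteq> {}"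
    if "U \<in> \<U>" for U
    using that unfolding scott_open_def by blast+
  show "scott_open L (\<Union>\<U>)"
    unfolding scott_open_def
  proof (intro conjI allI ballI impI)
    show "\<Union>\<U> \<subseteq> carrier L" using U(1) by blast
    show "y \<in> \<Union>\<U>" if "x \<in> \<Union>\<U>" "y \<in> carrier L" "x \<sqsubseteq>\<^bsub>L\<^esub> y" for x y
      using that U(2) by blast
    show "D \<inter> \<Union>\<U> \<noteq> {}"
      if "directed_in L D \<and> least L s (Upper L D) \<and> s \<in> \<Union>\<U>" for D s
      using that U(3) by blast
  qed
qed

lemma openin_scott_topology: "openin (scott_topology L) = scott_open L"
  by (simp add: scott_topology_def istopology_scott_open topology_inverse')

end

(* Under each of the six hypotheses one of two tools is available at every compact saturated K:
   compact saturated neighbourhoods that form a filter with intersection K, or a countable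
   decreasing base (U n) of open neighbourhoods. In the latter case K together with the tail of
   any sequence of compact saturated sets F n <= U n is again compact, and these sets decrease to K.
   Either way, a Scott open set containing K contains some box of an open neighbourhood of K, and
   well-filteredness with coherence makes (K, L) |-> K Int L continuous for the upper Vietoris
   topology. By this continuity an irreducible closed set of the Smyth power space is closed under
   binary intersections, hence is the closure of its intersection, and the intersection of two
   compact saturated sets of the power space is the image of their compact product. Thus the power
   space is sober, so well-filtered, and coherent, so a strong R-space. *)

theory Submission
  imports Defs
begin

section \<open>Saturated and compact saturated sets\<close>

text \<open>Intersection is only a partial operation on \<open>Q_sets X\<close>, because the empty
  set is compact and saturated but not a member. Its continuity is therefore stated with open sets
  of \<open>X\<close>: for disjoint \<open>K\<close> and \<open>L\<close> it provides disjoint open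
  neighbourhoods, and this is what keeps irreducible closed families of the power space away from
  disjoint members. Core-compactness speaks of open sets only. Compact neighbourhoods come from it
  through an interpolated sequence of open sets, each way below its predecessor; well-filteredness
  forces the intersection of the sequence to behave like a compact set. The countability conditions
  all yield a countable base at each compact \<open>K\<close>, although several of them bound only
  points or local bases at points. The passage uses that an open set containing a point contains
  everything above it, so a countable set of points below all of \<open>K\<close> controls the
  neighbourhoods of \<open>K\<close>, and compactness reduces covers to finite unions.\<close>

definition saturation :: "'a topology \<Rightarrow> 'a set \<Rightarrow> 'a set" where
  "saturation X A = \<Inter>{U. openin X U \<and> A \<subseteq> U}"

text \<open>This is the description of saturated sets as upper sets of the specialization order. For
  the converse, a point \<open>y\<close> outside \<open>S\<close> is avoided by an open set around
  each point of \<open>S\<close>, and the union of these is an open set that contains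
  \<open>S\<close> and avoids \<open>y\<close>.\<close>

lemma saturated_in_iff:
  "saturated_in X S \<longleftrightarrow> S \<subseteq> topspace X \<and>
     (\<forall>x\<in>S. \<forall>y. (\<forall>U. openin X U \<and> x \<in> U \<longrightarrow> y \<in> U) \<longrightarrow> y \<in> S)" (is "_ \<longleftrightarrow> ?R")
proof
  assume L: "saturated_in X S"
  have S: "S \<subseteq> topspace X" "\<Inter>{U. openin X U \<and> S \<subseteq> U} \<subseteq> S"
    using L[unfolded saturated_in_def] by (rule conjunct1, rule equalityD2[OF conjunct2])
  have "y \<in> S" if "x \<in> S" "\<forall>U. openin X U \<and> x \<in> U \<longrightarrow> y \<in> U" for x y
  proof -
    have "y \<in> \<Inter>{U. openin X U \<and> S \<subseteq> U}" using that by blast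
    then show ?thesis using S(2) by blast
  qed
  then show ?R using S(1) by blast
next
  assume R: ?R
  have "y \<in> S" if y: "\<forall>U. openin X U \<and> S \<subseteq> U \<longrightarrow> y \<in> U" for y
  proof (rule ccontr)
    assume "y \<notin> S"
    then have "\<forall>x\<in>S. \<exists>U. openin X U \<and> x \<in> U \<and> y \<notin> U" using R by blast
    then obtain f where f: "\<forall>x\<in>S. openin X (f x) \<and> x \<in> f x \<and> y \<notin> f x" by metis
    have "openin X (\<Union>(f ` S))" by (rule openin_Union) (use f in auto)
    moreover have "S \<subseteq> \<Union>(f ` S)" "y \<notin> \<Union>(f ` S)" using f by auto
    ultimately show False using y by blast
  qed
  then have "\<Inter>{U. openin X U \<and> S \<subseteq> U} = S" by blast
  then show "saturated_in X S" using R unfolding saturated_in_def by simp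
qed

lemma saturated_inD:
  assumes "saturated_in X S" "x \<in> S" "\<And>U. openin X U \<Longrightarrow> x \<in> U \<Longrightarrow> y \<in> U"
  shows "y \<in> S"
  using assms unfolding saturated_in_iff by simp

lemma saturated_inI:
  assumes "S \<subseteq> topspace X"
    and "\<And>x y. x \<in> S \<Longrightarrow> (\<And>U. openin X U \<Longrightarrow> x \<in> U \<Longrightarrow> y \<in> U) \<Longrightarrow> y \<in> S"
  shows "saturated_in X S"
  using assms unfolding saturated_in_iff by simp

lemma saturated_in_subset: "saturated_in X S \<Longrightarrow> S \<subseteq> topspace X"
  by (simp add: saturated_in_def)

lemma saturated_in_Union:
  assumes "\<And>S. S \<in> \<S> \<Longrightarrow> saturated_in X S"
  shows "saturated_in X (\<Union>\<S>)"
proof (rule saturated_inI)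
  show "\<Union>\<S> \<subseteq> topspace X" by (rule Union_least) (rule saturated_in_subset[OF assms])
  fix x y assume x: "x \<in> \<Union>\<S>" and y: "\<And>U. openin X U \<Longrightarrow> x \<in> U \<Longrightarrow> y \<in> U"
  from x obtain S where S: "S \<in> \<S>" "x \<in> S" by (rule UnionE)
  then have "y \<in> S" using saturated_inD[OF assms[OF S(1)]] y by simp
  then show "y \<in> \<Union>\<S>" using S(1) by (rule UnionI[rotated])
qed

lemma saturated_in_Un: "saturated_in X S \<Longrightarrow> saturated_in X T \<Longrightarrow> saturated_in X (S \<union> T)"
  using saturated_in_Union[of "{S, T}" X] by auto

lemma saturated_in_Inter:
  assumes "\<S> \<noteq> {}" "\<And>S. S \<in> \<S> \<Longrightarrow> saturated_in X S"
  shows "saturated_in X (\<Inter>\<S>)"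
proof (rule saturated_inI)
  show "\<Inter>\<S> \<subseteq> topspace X" using assms(1) by (rule Inter_subset[rotated]) (rule saturated_in_subset[OF assms(2)])
  fix x y assume x: "x \<in> \<Inter>\<S>" and y: "\<And>U. openin X U \<Longrightarrow> x \<in> U \<Longrightarrow> y \<in> U"
  show "y \<in> \<Inter>\<S>"
  proof (rule InterI)
    fix S assume S: "S \<in> \<S>"
    then show "y \<in> S" using saturated_inD[OF assms(2)[OF S], of x y] x y by simp
  qed
qed

lemma saturated_in_Int: "saturated_in X S \<Longrightarrow> saturated_in X T \<Longrightarrow> saturated_in X (S \<inter> T)"
  using saturated_in_Inter[of "{S, T}" X] by auto

lemma saturated_in_separation:
  assumes "saturated_in X S" "y \<notin> S"
  obtains U where "openin X U" "S \<subseteq> U" "y \<notin> U"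
proof -
  have "\<Inter>{U. openin X U \<and> S \<subseteq> U} \<subseteq> S"
    using assms(1)[unfolded saturated_in_def] by (rule equalityD2[OF conjunct2])
  then show thesis using assms(2) that by blast
qed

lemma subset_saturation: "A \<subseteq> saturation X A"
  unfolding saturation_def by blast

lemma saturation_subset_iff: "openin X U \<Longrightarrow> saturation X A \<subseteq> U \<longleftrightarrow> A \<subseteq> U"
  unfolding saturation_def by blast

lemma saturated_in_saturation:
  assumes "A \<subseteq> topspace X"
  shows "saturated_in X (saturation X A)"
proof -
  have "saturation X A \<subseteq> topspace X"
    using assms by (simp add: saturation_subset_iff)
  moreover have "{U. openin X U \<and> saturation X A \<subseteq> U} = {U. openin X U \<and> A \<subseteq> U}"
    using saturation_subset_iff by blast
  then have "saturation X A = \<Inter>{U. openin X U \<and> saturation X A \<subseteq> U}"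
    by (simp only: saturation_def)
  ultimately show ?thesis
    unfolding saturated_in_def by (rule conjI)
qed

lemma compactin_saturation:
  assumes "compactin X A"
  shows "compactin X (saturation X A)"
  unfolding compactin_def
proof (intro conjI allI impI)
  show "saturation X A \<subseteq> topspace X"
    using compactin_subset_topspace[OF assms] saturation_subset_iff[OF openin_topspace] by metis
  fix \<U> assume U: "Ball \<U> (openin X) \<and> saturation X A \<subseteq> \<Union>\<U>"
  then have "A \<subseteq> \<Union>\<U>" using subset_saturation[of A X] by (meson order_trans)
  then obtain \<F> where F: "finite \<F>" "\<F> \<subseteq> \<U>" "A \<subseteq> \<Union>\<F>"
    using assms U unfolding compactin_def by meson
  moreover have "openin X (\<Union>\<F>)" using F U by (blast intro: openin_Union)
  then have "saturation X A \<subseteq> \<Union>\<F>" using F(3) by (simp only: saturation_subset_iff)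
  ultimately show "\<exists>\<F>. finite \<F> \<and> \<F> \<subseteq> \<U> \<and> saturation X A \<subseteq> \<Union>\<F>"
    by metis
qed

lemma saturation_in_Q_sets:
  assumes "compactin X A" "A \<noteq> {}"
  shows "saturation X A \<in> Q_sets X"
proof -
  have "saturation X A \<noteq> {}"
    using assms(2) subset_saturation[of A X] by auto
  then show ?thesis
    using assms(1) unfolding Q_sets_def
    by (simp add: compactin_saturation saturated_in_saturation compactin_subset_topspace)
qed

lemma Q_setsD:
  assumes "K \<in> Q_sets X"
  shows "K \<noteq> {}" "compactin X K" "saturated_in X K" "K \<subseteq> topspace X"
  using assms compactin_subset_topspace unfolding Q_sets_def by auto

text \<open>The union of an open cover is an open set around \<open>S\<close>, and a compact set
  squeezed between the two passes its finite subcover on to \<open>S\<close>. It serves for filtered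
  intersections, where well-filteredness supplies the compact set.\<close>

lemma compactin_via_neighbourhoods:
  assumes "S \<subseteq> topspace X"
    and "\<And>W. openin X W \<Longrightarrow> S \<subseteq> W \<Longrightarrow> \<exists>K. compactin X K \<and> S \<subseteq> K \<and> K \<subseteq> W"
  shows "compactin X S"
  unfolding compactin_def
proof (intro conjI allI impI)
  fix \<U> assume U: "Ball \<U> (openin X) \<and> S \<subseteq> \<Union>\<U>"
  then have "openin X (\<Union>\<U>)" by (simp add: openin_Union)
  then obtain K where K: "compactin X K" "S \<subseteq> K" "K \<subseteq> \<Union>\<U>"
    using assms(2)[of "\<Union>\<U>"] U by auto
  then obtain \<F> where "finite \<F>" "\<F> \<subseteq> \<U>" "K \<subseteq> \<Union>\<F>"
    using U unfolding compactin_def by meson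
  then show "\<exists>\<F>. finite \<F> \<and> \<F> \<subseteq> \<U> \<and> S \<subseteq> \<Union>\<F>" using K by blast
qed (fact assms(1))

lemma well_filtered_Q_sets:
  assumes "well_filtered_space X" "\<K> \<subseteq> Q_sets X" "filtered_family \<K>" "openin X U" "\<Inter>\<K> \<subseteq> U"
  shows "\<exists>K\<in>\<K>. K \<subseteq> U"
  using assms unfolding well_filtered_space_def by simp

lemma well_filtered_compact_saturated:
  assumes "well_filtered_space X" "filtered_family \<K>" "openin X U" "\<Inter>\<K> \<subseteq> U"
    and "\<And>K. K \<in> \<K> \<Longrightarrow> compactin X K \<and> saturated_in X K"
  shows "\<exists>K\<in>\<K>. K \<subseteq> U"
\<comment> \<open>An empty member lies in every open set; without one the family lies in
  \<open>Q_sets X\<close>.\<close>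
proof (cases "{} \<in> \<K>")
  case False
  then have "\<K> \<subseteq> Q_sets X" using assms(5) unfolding Q_sets_def by auto
  then show ?thesis by (rule well_filtered_Q_sets[OF assms(1) _ assms(2-4)])
qed auto

text \<open>If the intersection were empty, well-filteredness with the empty open set would produce
  an empty member. Compactness follows because every open set around the intersection already
  contains a member of the family.\<close>

lemma Inter_filtered_in_Q_sets:
  assumes X: "well_filtered_space X" and K: "\<K> \<subseteq> Q_sets X" "filtered_family \<K>"
  shows "\<Inter>\<K> \<in> Q_sets X"
proof -
  have ne: "\<K> \<noteq> {}" using K unfolding filtered_family_def by blast
  have wf: "\<exists>K\<in>\<K>. K \<subseteq> U" if "openin X U" "\<Inter>\<K> \<subseteq> U" for U
    using well_filtered_Q_sets[OF X K that] .
  have "\<Inter>\<K> \<noteq> {}"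
  proof
    assume "\<Inter>\<K> = {}"
    then obtain K where "K \<in> \<K>" "K \<subseteq> {}" using wf[of "{}"] by auto
    then show False using K(1) Q_setsD(1)[of K X] by auto
  qed
  moreover have "saturated_in X (\<Inter>\<K>)"
    by (rule saturated_in_Inter[OF ne]) (use K Q_setsD(3) in auto)
  moreover have "compactin X (\<Inter>\<K>)"
  proof (rule compactin_via_neighbourhoods)
    show "\<Inter>\<K> \<subseteq> topspace X" using ne K(1) by (fastforce dest: Q_setsD(4))
    show "\<exists>K. compactin X K \<and> \<Inter>\<K> \<subseteq> K \<and> K \<subseteq> W" if W: "openin X W" "\<Inter>\<K> \<subseteq> W" for W
    proof -
      obtain K where "K \<in> \<K>" "K \<subseteq> W" using wf[OF W] by auto
      then show ?thesis using K(1) Q_setsD(2)[of K X] by blast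
    qed
  qed
  ultimately show ?thesis by (simp add: Q_sets_def)
qed


section \<open>Topologies on the power space\<close>

lemma openin_smyth_iff:
  "openin (smyth_power_space X) \<W> \<longleftrightarrow>
     \<W> \<subseteq> Q_sets X \<and> (\<forall>K\<in>\<W>. \<exists>U. openin X U \<and> K \<subseteq> U \<and> upper_box X U \<subseteq> \<W>)" (is "_ \<longleftrightarrow> ?R")
proof
  assume "openin (smyth_power_space X) \<W>"
  then have "\<exists>\<V>. \<V> \<subseteq> {B. \<exists>U. openin X U \<and> B = upper_box X U} \<and> \<Union>\<V> = \<W>"
    unfolding openin_smyth_power_space union_of_def by auto
  then obtain \<V> where V: "\<V> \<subseteq> {B. \<exists>U. openin X U \<and> B = upper_box X U}" "\<Union>\<V> = \<W>"
    by (elim exE conjE)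
  have "\<exists>U. openin X U \<and> K \<subseteq> U \<and> upper_box X U \<subseteq> \<W>" if K: "K \<in> \<W>" for K
  proof -
    obtain B where B: "B \<in> \<V>" "K \<in> B" using K V(2) by blast
    then obtain U where U: "openin X U" "B = upper_box X U" using V(1) by blast
    then have "K \<subseteq> U" using B(2) by (simp add: upper_box_def)
    then show ?thesis using U B(1) V(2) by blast
  qed
  moreover have "\<W> \<subseteq> Q_sets X"
    using V unfolding upper_box_def by blast
  ultimately show ?R by blast
next
  assume R: ?R
  let ?\<V> = "{B. (\<exists>U. openin X U \<and> B = upper_box X U) \<and> B \<subseteq> \<W>}"
  have "\<W> \<subseteq> \<Union>?\<V>"
  proof
    fix K assume "K \<in> \<W>"
    with R obtain U where "openin X U" "K \<subseteq> U" "upper_box X U \<subseteq> \<W>" "K \<in> Q_sets X" by blast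
    then show "K \<in> \<Union>?\<V>" by (auto simp: upper_box_def)
  qed
  then have "\<Union>?\<V> = \<W>" by blast
  moreover have "?\<V> \<subseteq> {B. \<exists>U. openin X U \<and> B = upper_box X U}" by blast
  ultimately have "\<exists>\<V>. \<V> \<subseteq> {B. \<exists>U. openin X U \<and> B = upper_box X U} \<and> \<Union>\<V> = \<W>"
    by (intro exI[of _ ?\<V>] conjI)
  then show "openin (smyth_power_space X) \<W>"
    unfolding openin_smyth_power_space union_of_def by (simp add: arbitrary_def)
qed

lemma in_upper_box_iff: "K \<in> upper_box X U \<longleftrightarrow> K \<in> Q_sets X \<and> K \<subseteq> U"
  by (simp add: upper_box_def)

lemma openin_upper_box:
  assumes "openin X U"
  shows "openin (smyth_power_space X) (upper_box X U)"
  unfolding openin_smyth_iff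
proof (intro conjI ballI)
  show "upper_box X U \<subseteq> Q_sets X" by (auto simp: in_upper_box_iff)
  show "\<exists>V. openin X V \<and> K \<subseteq> V \<and> upper_box X V \<subseteq> upper_box X U" if "K \<in> upper_box X U" for K
    by (rule exI[of _ U]) (use that assms in \<open>simp add: in_upper_box_iff\<close>)
qed

lemma openin_smythE:
  assumes "openin (smyth_power_space X) \<W>" "K \<in> \<W>"
  obtains U where "openin X U" "K \<subseteq> U" "upper_box X U \<subseteq> \<W>"
proof -
  have "\<exists>U. openin X U \<and> K \<subseteq> U \<and> upper_box X U \<subseteq> \<W>"
    using assms(1)[unfolded openin_smyth_iff, THEN conjunct2] assms(2) by (rule bspec)
  then show thesis using that by (elim exE conjE)
qed

lemma openin_smyth_upward:
  assumes "openin (smyth_power_space X) \<W>" "K \<in> \<W>" "L \<in> Q_sets X" "L \<subseteq> K"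
  shows "L \<in> \<W>"
proof -
  obtain U where U: "openin X U" "K \<subseteq> U" "upper_box X U \<subseteq> \<W>"
    using assms(1,2) by (rule openin_smythE)
  have "L \<in> upper_box X U" using assms(3,4) U(2) by (simp add: in_upper_box_iff order_trans)
  then show ?thesis using U(3) by (rule subsetD[rotated])
qed

text \<open>If \<open>L\<close> is not inside \<open>K\<close>, saturation of \<open>K\<close> gives
  an open set around \<open>K\<close> that misses a point of \<open>L\<close>, and its box contains
  \<open>K\<close> but not \<open>L\<close>.\<close>

lemma t0_smyth_power_space: "t0_space (smyth_power_space X)"
proof -
  have sep: "\<exists>U. openin (smyth_power_space X) U \<and> (L \<notin> U \<and> K \<in> U)"
    if KL: "K \<in> Q_sets X" "L \<in> Q_sets X" "\<not> L \<subseteq> K" for K L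
  proof -
    obtain y where "y \<in> L" "y \<notin> K" using KL by blast
    then obtain U where "openin X U" "K \<subseteq> U" "y \<notin> U"
      using saturated_in_separation Q_setsD(3) KL(1) by metis
    then have "L \<notin> upper_box X U" "K \<in> upper_box X U"
      using \<open>y \<in> L\<close> KL(1) unfolding upper_box_def by auto
    then show ?thesis
      using openin_upper_box[OF \<open>openin X U\<close>] by (intro exI[of _ "upper_box X U"]) simp
  qed
  show ?thesis
    unfolding t0_space_def topspace_smyth_power_space
  proof (intro ballI impI)
    fix K L assume KL: "K \<in> Q_sets X" "L \<in> Q_sets X" "K \<noteq> L"
    then consider "\<not> L \<subseteq> K" | "\<not> K \<subseteq> L" by auto
    then show "\<exists>U. openin (smyth_power_space X) U \<and> (K \<notin> U) = (L \<in> U)"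
      using sep[of K L] sep[of L K] KL(1,2) by cases auto
  qed
qed

lemma closure_of_singleton_smyth:
  assumes "M \<in> Q_sets X" "K \<in> Q_sets X" "M \<subseteq> K"
  shows "K \<in> smyth_power_space X closure_of {M}"
  unfolding in_closure_of topspace_smyth_power_space
  using assms openin_smyth_upward[of X _ K M] by auto

lemma least_smyth_order:
  assumes X: "well_filtered_space X" and D: "directed_in (smyth_order X) \<D>"
    and s: "least (smyth_order X) s (Upper (smyth_order X) \<D>)"
  shows "\<D> \<subseteq> Q_sets X" "filtered_family \<D>" "s = \<Inter>\<D>"
proof -
  show DQ: "\<D> \<subseteq> Q_sets X" and F: "filtered_family \<D>"
    using D unfolding directed_in_def filtered_family_def smyth_order_def by auto
  \<comment> \<open>Well-filteredness makes the intersection an element of the poset, hence a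
    competing upper bound that any supremum must be compared with.\<close>
  have "\<Inter>\<D> \<in> Q_sets X" using Inter_filtered_in_Q_sets[OF X DQ F] .
  then have "\<Inter>\<D> \<in> Upper (smyth_order X) \<D>"
    by (auto simp: Upper_def smyth_order_def)
  then have "\<Inter>\<D> \<subseteq> s" using s by (auto simp: least_def smyth_order_def)
  moreover have "s \<subseteq> \<Inter>\<D>"
    using s DQ by (auto simp: least_def Upper_def smyth_order_def)
  ultimately show "s = \<Inter>\<D>" by blast
qed

text \<open>Membership in \<open>\<U>\<close> places the intersection in \<open>Q_sets X\<close>,
  where it is the supremum of the filtered family for reverse inclusion.\<close>

lemma scott_open_smyth_filtered:
  assumes \<U>: "scott_open (smyth_order X) \<U>"
    and D: "\<D> \<subseteq> Q_sets X" "filtered_family \<D>" "\<Inter>\<D> \<in> \<U>"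
  shows "\<exists>K\<in>\<D>. K \<in> \<U>"
proof -
  have "\<U> \<subseteq> Q_sets X" using \<U> by (simp add: scott_open_def smyth_order_def)
  then have "\<Inter>\<D> \<in> Q_sets X" using D(3) by (rule subsetD)
  then have "least (smyth_order X) (\<Inter>\<D>) (Upper (smyth_order X) \<D>)"
    using D(1) by (auto simp: least_def Upper_def smyth_order_def subset_iff)
  moreover have "directed_in (smyth_order X) \<D>"
    using D unfolding directed_in_def filtered_family_def smyth_order_def by simp
  ultimately have "\<D> \<inter> \<U> \<noteq> {}" using \<U> D(3) unfolding scott_open_def by blast
  then show ?thesis by blast
qed

lemma scott_open_if_openin_smyth:
  assumes X: "well_filtered_space X" and \<W>: "openin (smyth_power_space X) \<W>"
  shows "scott_open (smyth_order X) \<W>"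
  unfolding scott_open_def
proof (intro conjI allI ballI impI)
  show "\<W> \<subseteq> carrier (smyth_order X)"
    using \<W> unfolding openin_smyth_iff smyth_order_def by simp
  show "L \<in> \<W>" if "K \<in> \<W>" "L \<in> carrier (smyth_order X)" "K \<sqsubseteq>\<^bsub>smyth_order X\<^esub> L" for K L
    using openin_smyth_upward[OF \<W> that(1)] that by (simp add: smyth_order_def)
  fix \<D> s
  assume "directed_in (smyth_order X) \<D> \<and>
    least (smyth_order X) s (Upper (smyth_order X) \<D>) \<and> s \<in> \<W>"
  then have s: "\<D> \<subseteq> Q_sets X" "filtered_family \<D>" "\<Inter>\<D> \<in> \<W>"
    using least_smyth_order[OF X, of \<D> s] by simp_all
  obtain U where U: "openin X U" "\<Inter>\<D> \<subseteq> U" "upper_box X U \<subseteq> \<W>"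
    using \<W> s(3) by (rule openin_smythE)
  obtain K where K: "K \<in> \<D>" "K \<subseteq> U"
    using well_filtered_Q_sets[OF X s(1,2) U(1,2)] by auto
  have "K \<in> upper_box X U" using K s(1) by (auto simp: in_upper_box_iff)
  then show "\<D> \<inter> \<W> \<noteq> {}" using K(1) U(3) by auto
qed

text \<open>The nontrivial inclusion between the two topologies, localised at a compact set so that
  compact neighbourhoods and countable bases can each supply it.\<close>

definition scott_boxed :: "'a topology \<Rightarrow> bool" where
  "scott_boxed X \<longleftrightarrow> (\<forall>\<U> K. scott_open (smyth_order X) \<U> \<and> K \<in> \<U> \<longrightarrow>
     (\<exists>U. openin X U \<and> K \<subseteq> U \<and> upper_box X U \<subseteq> \<U>))"

lemma smyth_eq_scott_power_space:
  assumes "well_filtered_space X" "scott_boxed X"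
  shows "smyth_power_space X = scott_power_space X"
proof -
  have "openin (smyth_power_space X) \<W> \<longleftrightarrow> scott_open (smyth_order X) \<W>" for \<W>
  proof
    assume \<W>: "scott_open (smyth_order X) \<W>"
    then have "\<W> \<subseteq> Q_sets X" by (simp add: scott_open_def smyth_order_def)
    moreover have "\<exists>U. openin X U \<and> K \<subseteq> U \<and> upper_box X U \<subseteq> \<W>" if "K \<in> \<W>" for K
      using assms(2) \<W> that unfolding scott_boxed_def by simp
    ultimately show "openin (smyth_power_space X) \<W>"
      unfolding openin_smyth_iff by simp
  qed (rule scott_open_if_openin_smyth[OF assms(1)])
  then show ?thesis
    by (simp add: topology_eq scott_power_space_def openin_scott_topology)
qed

text \<open>Continuity of the binary supremum of the Smyth order at \<open>(K, L)\<close>, written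
  so that it also makes sense when \<open>K \<inter> L\<close> is empty.\<close>

definition intersection_continuous :: "'a topology \<Rightarrow> bool" where
  "intersection_continuous X \<longleftrightarrow>
     (\<forall>K\<in>Q_sets X. \<forall>L\<in>Q_sets X. \<forall>W. openin X W \<and> K \<inter> L \<subseteq> W \<longrightarrow>
       (\<exists>U V. openin X U \<and> openin X V \<and> K \<subseteq> U \<and> L \<subseteq> V \<and> U \<inter> V \<subseteq> W))"

lemma Int_in_Q_sets:
  assumes "coherent_space X" "K \<in> Q_sets X" "L \<in> Q_sets X" "K \<inter> L \<noteq> {}"
  shows "K \<inter> L \<in> Q_sets X"
  using assms saturated_in_Int[of X K L] unfolding coherent_space_def Q_sets_def by simp


section \<open>Countable neighbourhood bases\<close>

definition countable_base_at :: "'a topology \<Rightarrow> 'a set \<Rightarrow> bool" where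
  "countable_base_at X K \<longleftrightarrow> (\<exists>\<C>. countable \<C> \<and> (\<forall>U\<in>\<C>. openin X U \<and> K \<subseteq> U) \<and>
     (\<forall>V. openin X V \<and> K \<subseteq> V \<longrightarrow> (\<exists>U\<in>\<C>. U \<subseteq> V)))"

definition decreasing_base_at :: "'a topology \<Rightarrow> 'a set \<Rightarrow> (nat \<Rightarrow> 'a set) \<Rightarrow> bool" where
  "decreasing_base_at X K U \<longleftrightarrow> decseq U \<and> (\<forall>n. openin X (U n) \<and> K \<subseteq> U n) \<and>
     (\<forall>V. openin X V \<and> K \<subseteq> V \<longrightarrow> (\<exists>n. U n \<subseteq> V))"

lemma decreasing_base_exists:
  assumes "countable_base_at X K" "K \<subseteq> topspace X"
  obtains U where "decreasing_base_at X K U"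
proof -
  obtain \<C> where C: "countable \<C>" "\<And>U. U \<in> \<C> \<Longrightarrow> openin X U \<and> K \<subseteq> U"
    "\<And>V. openin X V \<Longrightarrow> K \<subseteq> V \<Longrightarrow> \<exists>U\<in>\<C>. U \<subseteq> V"
    using assms(1) unfolding countable_base_at_def by metis
  \<comment> \<open>\<open>from_nat_into\<close> enumerates nonempty sets only; the whole space is a
    neighbourhood of \<open>K\<close>, so the base has a member.\<close>
  have ne: "\<C> \<noteq> {}" using C(3)[of "topspace X"] assms(2) by blast
  define U where "U n = (\<Inter>i\<le>n. from_nat_into \<C> i)" for n
  have mem: "from_nat_into \<C> i \<in> \<C>" for i using ne by (rule from_nat_into)
  have "decseq U" unfolding decseq_def U_def by (auto intro: order_trans)
  moreover have "openin X (U n) \<and> K \<subseteq> U n" for n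
    unfolding U_def using C(2)[OF mem] by (auto intro!: openin_Inter)
  moreover have "\<exists>n. U n \<subseteq> V" if V: "openin X V" "K \<subseteq> V" for V
  proof -
    obtain W where W: "W \<in> \<C>" "W \<subseteq> V" using C(3)[OF V] by blast
    then obtain n where "from_nat_into \<C> n = W" using from_nat_into_surj C(1) by metis
    then show ?thesis using W(2) unfolding U_def by blast
  qed
  ultimately show thesis
    using that[of U] unfolding decreasing_base_at_def by simp
qed

section \<open>Tails of a sequence of compact sets attached to a compact set\<close>

definition tail_union :: "'a set \<Rightarrow> (nat \<Rightarrow> 'a set) \<Rightarrow> nat \<Rightarrow> 'a set" where
  "tail_union K F n = K \<union> (\<Union>m\<in>{n..}. F m)"

lemma decseq_tail_union: "decseq (tail_union K F)"
  unfolding decseq_def tail_union_def by fastforce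

lemma filtered_family_range_decseq:
  fixes F :: "nat \<Rightarrow> 'a set"
  assumes "decseq F"
  shows "filtered_family (range F)"
  unfolding filtered_family_def
proof (intro conjI ballI)
  fix A B assume "A \<in> range F" "B \<in> range F"
  then obtain m n where "A = F m" "B = F n" by auto
  then have "F (max m n) \<subseteq> A \<inter> B"
    using decseqD[OF assms, of m "max m n"] decseqD[OF assms, of n "max m n"] by simp
  then show "\<exists>C\<in>range F. C \<subseteq> A \<inter> B" by auto
qed simp

text \<open>An open set containing \<open>K\<close> contains all but finitely many \<open>F m\<close>.\<close>

lemma compactin_tail_union:
  assumes K: "compactin X K" and U: "decreasing_base_at X K U"
    and F: "\<And>n. compactin X (F n)" "\<And>n. F n \<subseteq> U n"
  shows "compactin X (tail_union K F n)"
  unfolding compactin_def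
proof (intro conjI allI impI)
  show "tail_union K F n \<subseteq> topspace X"
    unfolding tail_union_def
    using compactin_subset_topspace[OF K] compactin_subset_topspace[OF F(1)] by (simp add: UN_subset_iff)
  fix \<V> assume V: "Ball \<V> (openin X) \<and> tail_union K F n \<subseteq> \<Union>\<V>"
  then have "K \<subseteq> \<Union>\<V>" by (simp add: tail_union_def)
  then obtain \<F> where F1: "finite \<F>" "\<F> \<subseteq> \<V>" "K \<subseteq> \<Union>\<F>"
    using K V unfolding compactin_def by meson
  have "openin X (\<Union>\<F>)" using F1(2) V by (intro openin_Union) auto
  then obtain k where k: "U k \<subseteq> \<Union>\<F>"
    using U F1(3) unfolding decreasing_base_at_def by meson
  have tail: "F m \<subseteq> \<Union>\<F>" if "k \<le> m" for m
    using F(2)[of m] decseqD[of U k m] U that k unfolding decreasing_base_at_def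
    by (meson order_trans)
  have "compactin X (\<Union>(F ` {n..<k}))"
    by (rule compactin_Union) (use F(1) in auto)
  moreover have "\<Union>(F ` {n..<k}) \<subseteq> tail_union K F n" by (auto simp: tail_union_def)
  then have "\<Union>(F ` {n..<k}) \<subseteq> \<Union>\<V>" using V by (meson order_trans)
  ultimately obtain \<G> where G: "finite \<G>" "\<G> \<subseteq> \<V>" "\<Union>(F ` {n..<k}) \<subseteq> \<Union>\<G>"
    using V unfolding compactin_def by meson
  have "F m \<subseteq> \<Union>(\<F> \<union> \<G>)" if "n \<le> m" for m
  proof (cases "k \<le> m")
    case True
    then show ?thesis using tail[of m] by auto
  next
    case False
    then have "F m \<subseteq> \<Union>(F ` {n..<k})" using that by (intro UN_upper) auto
    then show ?thesis using G(3) by auto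
  qed
  then have "tail_union K F n \<subseteq> \<Union>(\<F> \<union> \<G>)"
    using F1(3) unfolding tail_union_def by (simp add: UN_subset_iff le_supI1)
  then show "\<exists>\<H>. finite \<H> \<and> \<H> \<subseteq> \<V> \<and> tail_union K F n \<subseteq> \<Union>\<H>"
    using F1 G by (intro exI[of _ "\<F> \<union> \<G>"]) auto
qed

lemma tail_union_in_Q_sets:
  assumes K: "K \<in> Q_sets X" and U: "decreasing_base_at X K U"
    and F: "\<And>n. F n \<in> Q_sets X" "\<And>n. F n \<subseteq> U n"
  shows "tail_union K F n \<in> Q_sets X"
proof -
  have "compactin X (tail_union K F n)"
    using Q_setsD(2)[OF K] U Q_setsD(2)[OF F(1)] F(2) by (rule compactin_tail_union)
  moreover have "saturated_in X (tail_union K F n)"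
    unfolding tail_union_def
    by (intro saturated_in_Un saturated_in_Union Q_setsD(3)[OF K]) (use F(1) Q_setsD(3) in auto)
  moreover have "tail_union K F n \<noteq> {}"
    using Q_setsD(1)[OF K] by (simp add: tail_union_def)
  ultimately show ?thesis by (simp add: Q_sets_def)
qed

text \<open>A point outside the saturated set \<open>K\<close> is missed by an open set around
  \<open>K\<close>, hence by some \<open>U k\<close>, and all \<open>F m\<close> with
  \<open>k \<le> m\<close> lie in \<open>U k\<close>.\<close>

lemma Inter_tail_union:
  assumes K: "saturated_in X K" and U: "decreasing_base_at X K U"
    and F: "\<And>n. F n \<subseteq> U n"
  shows "\<Inter>(range (tail_union K F)) = K"
proof (intro subset_antisym subsetI)
  fix y assume y: "y \<in> \<Inter>(range (tail_union K F))"
  show "y \<in> K"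
  proof (rule ccontr)
    assume "y \<notin> K"
    then obtain V where V: "openin X V" "K \<subseteq> V" "y \<notin> V"
      using saturated_in_separation[OF K] by metis
    then obtain k where k: "U k \<subseteq> V"
      using U unfolding decreasing_base_at_def by meson
    have "y \<in> tail_union K F k" using y by auto
    then obtain m where m: "k \<le> m" "y \<in> F m"
      using \<open>y \<notin> K\<close> by (auto simp: tail_union_def)
    have "U m \<subseteq> U k" using U m(1) by (simp add: decreasing_base_at_def decseqD)
    then show False using m(2) F[of m] k V(3) by auto
  qed
qed (auto simp: tail_union_def)

text \<open>If no box around \<open>K\<close> fits, every \<open>U n\<close> contains some
  \<open>F n\<close> outside \<open>\<U>\<close>. The tails decrease to \<open>K\<close>, so Scott
  openness puts one of them into \<open>\<U>\<close>; its subset \<open>F n\<close> is larger in the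
  Smyth order and would have to follow.\<close>

lemma scott_boxed_if_countable_base:
  assumes "\<And>K. K \<in> Q_sets X \<Longrightarrow> countable_base_at X K"
  shows "scott_boxed X"
  unfolding scott_boxed_def
proof (intro allI impI, elim conjE)
  fix \<U> K assume \<U>: "scott_open (smyth_order X) \<U>" and K\<U>: "K \<in> \<U>"
  then have K: "K \<in> Q_sets X" by (auto simp: scott_open_def smyth_order_def)
  obtain U where U: "decreasing_base_at X K U"
    using assms[OF K] Q_setsD(4)[OF K] by (rule decreasing_base_exists)
  then have Uo: "openin X (U n)" "K \<subseteq> U n" for n
    by (simp_all add: decreasing_base_at_def)
  show "\<exists>U. openin X U \<and> K \<subseteq> U \<and> upper_box X U \<subseteq> \<U>"
  proof (rule ccontr)
    assume "\<not> ?thesis"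
    then have "\<exists>F. F \<in> upper_box X (U n) \<and> F \<notin> \<U>" for n
      using Uo[of n] by (meson subsetI)
    then obtain F where F: "\<And>n. F n \<in> upper_box X (U n)" "\<And>n. F n \<notin> \<U>" by metis
    then have FQ: "F n \<in> Q_sets X" "F n \<subseteq> U n" for n by (simp_all add: in_upper_box_iff)
    note tail = tail_union_in_Q_sets[OF K U FQ]
    have "\<Inter>(range (tail_union K F)) \<in> \<U>"
      using Inter_tail_union[OF Q_setsD(3)[OF K] U FQ(2)] K\<U> by simp
    moreover have "range (tail_union K F) \<subseteq> Q_sets X" using tail by auto
    ultimately obtain n where n: "tail_union K F n \<in> \<U>"
      using scott_open_smyth_filtered[OF \<U> _ filtered_family_range_decseq[OF decseq_tail_union]]
      by fastforce
    have "F n \<subseteq> tail_union K F n" by (auto simp: tail_union_def)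
    then have "F n \<in> \<U>"
      using \<U> n FQ(1)[of n] by (simp add: scott_open_def smyth_order_def)
    then show False using F(2) by simp
  qed
qed

text \<open>A failure gives points \<open>x n\<close> in \<open>U n \<inter> V n\<close> outside
  \<open>W\<close>. Attaching the tails of their saturations to \<open>K\<close> and to
  \<open>L\<close> yields two decreasing sequences of compact sets; coherence makes the termwise
  intersections compact, and they decrease to \<open>K \<inter> L\<close>. Well-filteredness then
  traps one of them, together with its point \<open>x n\<close>, inside \<open>W\<close>.\<close>

lemma intersection_continuous_if_countable_base:
  assumes X: "well_filtered_space X" "coherent_space X"
    and base: "\<And>K. K \<in> Q_sets X \<Longrightarrow> countable_base_at X K"
  shows "intersection_continuous X"
  unfolding intersection_continuous_def
proof (intro ballI allI impI, elim conjE)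
  fix K L W assume K: "K \<in> Q_sets X" and L: "L \<in> Q_sets X"
    and W: "openin X W" "K \<inter> L \<subseteq> W"
  obtain U where U: "decreasing_base_at X K U"
    using base[OF K] Q_setsD(4)[OF K] by (rule decreasing_base_exists)
  obtain V where V: "decreasing_base_at X L V"
    using base[OF L] Q_setsD(4)[OF L] by (rule decreasing_base_exists)
  have UV: "openin X (U n)" "K \<subseteq> U n" "openin X (V n)" "L \<subseteq> V n" for n
    using U V by (simp_all add: decreasing_base_at_def)
  show "\<exists>U V. openin X U \<and> openin X V \<and> K \<subseteq> U \<and> L \<subseteq> V \<and> U \<inter> V \<subseteq> W"
  proof (rule ccontr)
    assume neg: "\<not> ?thesis"
    have "\<exists>x. x \<in> U n \<inter> V n \<and> x \<notin> W" for n
      using neg UV[of n] by (meson subsetI)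
    then obtain x where x: "\<And>n. x n \<in> U n \<inter> V n" "\<And>n. x n \<notin> W" by metis
    define F where "F n = saturation X {x n}" for n
    have xt: "x n \<in> topspace X" for n using x(1)[of n] UV(1)[of n] openin_subset by fastforce
    have F: "F n \<in> Q_sets X" "F n \<subseteq> U n" "F n \<subseteq> V n" "x n \<in> F n" for n
      unfolding F_def using x(1)[of n] xt[of n] UV[of n] subset_saturation[of "{x n}" X]
      by (simp_all add: saturation_in_Q_sets saturation_subset_iff)
    define G where "G n = tail_union K F n \<inter> tail_union L F n" for n
    note TK = tail_union_in_Q_sets[OF K U F(1,2)] and TL = tail_union_in_Q_sets[OF L V F(1,3)]
    \<comment> \<open>The point \<open>x n\<close> keeps \<open>G n\<close> nonempty, so
      \<open>G n\<close> belongs to \<open>Q_sets X\<close> even when \<open>K\<close> and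
      \<open>L\<close> are disjoint.\<close>
    have xG: "x n \<in> G n" for n using F(4)[of n] by (auto simp: G_def tail_union_def)
    have GQ: "G n \<in> Q_sets X" for n
      unfolding G_def by (rule Int_in_Q_sets[OF X(2) TK TL]) (use xG[of n] in \<open>auto simp: G_def\<close>)
    have "decseq G"
      using decseq_tail_union[of K F] decseq_tail_union[of L F]
      unfolding decseq_def G_def by (simp add: le_infI1 le_infI2)
    moreover have "\<Inter>(range G) = K \<inter> L"
      using Inter_tail_union[OF Q_setsD(3)[OF K] U F(2)] Inter_tail_union[OF Q_setsD(3)[OF L] V F(3)]
      unfolding G_def by (simp add: INT_Int_distrib)
    ultimately obtain n where "G n \<subseteq> W"
      using well_filtered_Q_sets[OF X(1) _ filtered_family_range_decseq[of G] W(1)] GQ W(2) by auto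
    then show False using xG[of n] x(2)[of n] by auto
  qed
qed


section \<open>Locally compact spaces\<close>

text \<open>Finitely many compact neighbourhoods inside \<open>V\<close> have interiors covering
  \<open>K\<close>. Saturating their union keeps it compact and, since \<open>V\<close> is open,
  inside \<open>V\<close>.\<close>

lemma compact_saturated_between:
  assumes X: "locally_compact_T0 X" and K: "compactin X K" "openin X V" "K \<subseteq> V"
  obtains Q U where "compactin X Q" "saturated_in X Q" "openin X U" "K \<subseteq> U" "U \<subseteq> Q" "Q \<subseteq> V"
proof -
  have "\<exists>Q. compactin X Q \<and> x \<in> X interior_of Q \<and> Q \<subseteq> V" if x: "x \<in> K" for x
    using X K(2) subsetD[OF K(3) x] unfolding locally_compact_T0_def by simp
  then obtain q where q: "\<And>x. x \<in> K \<Longrightarrow> compactin X (q x) \<and> x \<in> X interior_of (q x) \<and> q x \<subseteq> V"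
    by metis
  have "K \<subseteq> \<Union>((\<lambda>x. X interior_of (q x)) ` K)" using q by auto
  moreover have "\<And>U. U \<in> (\<lambda>x. X interior_of (q x)) ` K \<Longrightarrow> openin X U" by auto
  ultimately have "\<exists>\<F>. finite \<F> \<and> \<F> \<subseteq> (\<lambda>x. X interior_of (q x)) ` K \<and> K \<subseteq> \<Union>\<F>"
    using K(1) unfolding compactin_def by simp
  then obtain T where T: "finite T" "T \<subseteq> K" "K \<subseteq> \<Union>((\<lambda>x. X interior_of (q x)) ` T)"
    by (metis finite_subset_image)
  define C where "C = \<Union>(q ` T)"
  define U where "U = \<Union>((\<lambda>x. X interior_of (q x)) ` T)"
  have C: "compactin X C"
    unfolding C_def using T q by (intro compactin_Union) auto
  have "U \<subseteq> C" unfolding U_def C_def by (intro UN_mono) (simp_all add: interior_of_subset)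
  then have "U \<subseteq> saturation X C" using subset_saturation[of C X] by (rule order_trans)
  moreover have "saturation X C \<subseteq> V"
    using q T(2) unfolding saturation_subset_iff[OF K(2)] C_def by (intro UN_least) auto
  moreover have "openin X U" unfolding U_def by (intro openin_Union) auto
  moreover have "K \<subseteq> U" using T(3) by (simp add: U_def)
  ultimately show thesis
    using that[of "saturation X C" U] C
    by (simp add: compactin_saturation saturated_in_saturation compactin_subset_topspace)
qed

definition compact_neighbourhoods :: "'a topology \<Rightarrow> 'a set \<Rightarrow> 'a set set" where
  "compact_neighbourhoods X K =
     {Q. compactin X Q \<and> saturated_in X Q \<and> (\<exists>U. openin X U \<and> K \<subseteq> U \<and> U \<subseteq> Q)}"

lemma compact_neighbourhood_in_open:
  assumes "locally_compact_T0 X" "compactin X K" "openin X V" "K \<subseteq> V"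
  shows "\<exists>Q\<in>compact_neighbourhoods X K. Q \<subseteq> V"
proof -
  obtain Q U where "compactin X Q" "saturated_in X Q" "openin X U" "K \<subseteq> U" "U \<subseteq> Q" "Q \<subseteq> V"
    using assms by (rule compact_saturated_between)
  then show ?thesis unfolding compact_neighbourhoods_def by (intro bexI[of _ Q]) auto
qed

lemma compact_neighbourhoodsE:
  assumes "Q \<in> compact_neighbourhoods X K"
  obtains U where "compactin X Q" "saturated_in X Q" "openin X U" "K \<subseteq> U" "U \<subseteq> Q"
  using assms unfolding compact_neighbourhoods_def by auto

lemma filtered_compact_neighbourhoods:
  assumes X: "locally_compact_T0 X" and K: "compactin X K"
  shows "filtered_family (compact_neighbourhoods X K)"
  unfolding filtered_family_def
proof (intro conjI ballI)
  show "compact_neighbourhoods X K \<noteq> {}"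
    using compact_neighbourhood_in_open[OF X K openin_topspace compactin_subset_topspace[OF K]] by auto
  fix P Q assume P: "P \<in> compact_neighbourhoods X K" and Q: "Q \<in> compact_neighbourhoods X K"
  obtain U where U: "openin X U" "K \<subseteq> U" "U \<subseteq> P" using P by (rule compact_neighbourhoodsE)
  obtain V where V: "openin X V" "K \<subseteq> V" "V \<subseteq> Q" using Q by (rule compact_neighbourhoodsE)
  have "\<exists>R\<in>compact_neighbourhoods X K. R \<subseteq> U \<inter> V"
    using U V by (intro compact_neighbourhood_in_open[OF X K] openin_Int) auto
  then show "\<exists>R\<in>compact_neighbourhoods X K. R \<subseteq> P \<inter> Q"
    using U(3) V(3) by (meson Int_mono order_trans)
qed

lemma Inter_compact_neighbourhoods:
  assumes X: "locally_compact_T0 X" and K: "compactin X K" "saturated_in X K"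
  shows "\<Inter>(compact_neighbourhoods X K) = K"
proof (intro subset_antisym subsetI)
  fix y assume y: "y \<in> \<Inter>(compact_neighbourhoods X K)"
  show "y \<in> K"
  proof (rule ccontr)
    assume "y \<notin> K"
    then obtain V where V: "openin X V" "K \<subseteq> V" "y \<notin> V"
      using saturated_in_separation[OF K(2)] by metis
    then obtain Q where "Q \<in> compact_neighbourhoods X K" "Q \<subseteq> V"
      using compact_neighbourhood_in_open[OF X K(1) V(1,2)] by auto
    then show False using y V(3) by auto
  qed
next
  fix y assume "y \<in> K"
  then show "y \<in> \<Inter>(compact_neighbourhoods X K)"
    unfolding compact_neighbourhoods_def by auto
qed

text \<open>The compact neighbourhoods of \<open>K\<close> are filtered with intersection
  \<open>K\<close>, so one of them lies in \<open>\<U>\<close>. Every member of the box of an open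
  set inside that neighbourhood is above it in the Smyth order.\<close>

lemma scott_boxed_if_locally_compact:
  assumes X: "locally_compact_T0 X"
  shows "scott_boxed X"
  unfolding scott_boxed_def
proof (intro allI impI, elim conjE)
  fix \<U> K assume \<U>: "scott_open (smyth_order X) \<U>" and K\<U>: "K \<in> \<U>"
  then have K: "K \<in> Q_sets X" by (auto simp: scott_open_def smyth_order_def)
  have Q: "compact_neighbourhoods X K \<subseteq> Q_sets X"
    using Q_setsD(1)[OF K] unfolding compact_neighbourhoods_def Q_sets_def by auto
  moreover have "\<Inter>(compact_neighbourhoods X K) \<in> \<U>"
    using Inter_compact_neighbourhoods[OF X Q_setsD(2,3)[OF K]] K\<U> by simp
  ultimately obtain Q where Q: "Q \<in> compact_neighbourhoods X K" "Q \<in> \<U>"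
    using scott_open_smyth_filtered[OF \<U> _ filtered_compact_neighbourhoods[OF X Q_setsD(2)[OF K]]]
    by auto
  obtain U where U: "openin X U" "K \<subseteq> U" "U \<subseteq> Q" using Q(1) by (rule compact_neighbourhoodsE)
  have "L \<in> \<U>" if "L \<in> upper_box X U" for L
  proof -
    have "L \<in> Q_sets X" "L \<subseteq> Q" using that U(3) by (auto simp: in_upper_box_iff)
    then show ?thesis using \<U> Q(2) by (simp add: scott_open_def smyth_order_def)
  qed
  then show "\<exists>U. openin X U \<and> K \<subseteq> U \<and> upper_box X U \<subseteq> \<U>"
    using U by (intro exI[of _ U]) auto
qed

lemma intersection_continuous_if_locally_compact:
  assumes X: "well_filtered_space X" "coherent_space X" "locally_compact_T0 X"
  shows "intersection_continuous X"
  unfolding intersection_continuous_def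
proof (intro ballI allI impI, elim conjE)
  fix K L W assume K: "K \<in> Q_sets X" and L: "L \<in> Q_sets X"
    and W: "openin X W" "K \<inter> L \<subseteq> W"
  let ?N = "compact_neighbourhoods X"
  define \<M> where "\<M> = (\<lambda>(P, Q). P \<inter> Q) ` (?N K \<times> ?N L)"
  note FK = filtered_compact_neighbourhoods[OF X(3) Q_setsD(2)[OF K]]
    and FL = filtered_compact_neighbourhoods[OF X(3) Q_setsD(2)[OF L]]
  have "filtered_family \<M>"
    unfolding filtered_family_def
  proof (intro conjI ballI)
    show "\<M> \<noteq> {}" using FK FL unfolding \<M>_def filtered_family_def by simp
    fix A B assume "A \<in> \<M>" "B \<in> \<M>"
    then obtain P Q R S where A: "A = P \<inter> Q" "P \<in> ?N K" "Q \<in> ?N L"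
      and B: "B = R \<inter> S" "R \<in> ?N K" "S \<in> ?N L"
      unfolding \<M>_def by auto
    obtain T where T: "T \<in> ?N K" "T \<subseteq> P \<inter> R"
      using FK A(2) B(2) unfolding filtered_family_def by meson
    obtain T' where T': "T' \<in> ?N L" "T' \<subseteq> Q \<inter> S"
      using FL A(3) B(3) unfolding filtered_family_def by meson
    have "T \<inter> T' \<in> \<M>" using T(1) T'(1) unfolding \<M>_def by auto
    moreover have "T \<inter> T' \<subseteq> A \<inter> B" using T(2) T'(2) A(1) B(1) by auto
    ultimately show "\<exists>C\<in>\<M>. C \<subseteq> A \<inter> B" by auto
  qed
  moreover have "\<Inter>\<M> \<subseteq> W"
  proof
    fix y assume y: "y \<in> \<Inter>\<M>"
    have PQ: "y \<in> P \<inter> Q" if "P \<in> ?N K" "Q \<in> ?N L" for P Q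
      using y that unfolding \<M>_def by auto
    \<comment> \<open>Passing from all sets \<open>P \<inter> Q\<close> to all \<open>P\<close>, and
      to all \<open>Q\<close>, requires one neighbourhood on the other side.\<close>
    obtain P Q where "P \<in> ?N K" "Q \<in> ?N L"
      using FK FL unfolding filtered_family_def by auto
    then have "y \<in> \<Inter>(?N K)" "y \<in> \<Inter>(?N L)" using PQ by auto
    then show "y \<in> W"
      using W(2) Inter_compact_neighbourhoods[OF X(3) Q_setsD(2,3)[OF K]]
        Inter_compact_neighbourhoods[OF X(3) Q_setsD(2,3)[OF L]] by auto
  qed
  moreover have "compactin X M \<and> saturated_in X M" if "M \<in> \<M>" for M
  proof -
    from that obtain P Q where M: "M = P \<inter> Q" "P \<in> ?N K" "Q \<in> ?N L"
      unfolding \<M>_def by auto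
    then have "compactin X P" "saturated_in X P" "compactin X Q" "saturated_in X Q"
      by (auto simp: compact_neighbourhoods_def)
    then show ?thesis
      using X(2) saturated_in_Int[of X P Q] M(1) unfolding coherent_space_def by simp
  qed
  \<comment> \<open>Members of \<open>\<M>\<close> may be empty, hence the form of well-filteredness
    for arbitrary compact saturated sets.\<close>
  ultimately obtain M where M: "M \<in> \<M>" "M \<subseteq> W"
    using well_filtered_compact_saturated[OF X(1) _ W(1), of \<M>] by auto
  then obtain P Q where PQ: "M = P \<inter> Q" "P \<in> ?N K" "Q \<in> ?N L"
    unfolding \<M>_def by auto
  obtain U where U: "openin X U" "K \<subseteq> U" "U \<subseteq> P" using PQ(2) by (rule compact_neighbourhoodsE)
  obtain V where V: "openin X V" "L \<subseteq> V" "V \<subseteq> Q" using PQ(3) by (rule compact_neighbourhoodsE)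
  have "U \<inter> V \<subseteq> W" using U(3) V(3) M(2) PQ(1) by (meson Int_mono order_trans)
  then show "\<exists>U V. openin X U \<and> openin X V \<and> K \<subseteq> U \<and> L \<subseteq> V \<and> U \<inter> V \<subseteq> W"
    using U(1,2) V(1,2) by (intro exI[of _ U] exI[of _ V] conjI)
qed


section \<open>Core-compact well-filtered spaces are locally compact\<close>

definition maximal_open_avoiding :: "'a topology \<Rightarrow> 'a set \<Rightarrow> 'a set set \<Rightarrow> 'a set \<Rightarrow> bool" where
  "maximal_open_avoiding X U \<S> M \<longleftrightarrow> openin X M \<and> U \<subseteq> M \<and> (\<forall>S\<in>\<S>. \<not> S \<subseteq> M) \<and>
     (\<forall>G. openin X G \<and> \<not> G \<subseteq> M \<longrightarrow> (\<exists>S\<in>\<S>. S \<subseteq> M \<union> G))"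

text \<open>Zorn's lemma, with the finiteness that passes to unions of chains left as the hypothesis
  \<open>chain\<close>. Compactness of \<open>S\<close> provides it with \<open>T = S\<close>; for a
  way-below sequence \<open>T\<close> is the successor of \<open>S\<close>. Maximality is recorded
  in the form in which it is applied: adding an open set not inside \<open>M\<close> swallows a
  member of \<open>\<S>\<close>.\<close>

lemma maximal_open_exists:
  assumes U: "openin X U" "\<And>S. S \<in> \<S> \<Longrightarrow> \<not> S \<subseteq> U"
    and chain: "\<And>\<C> S. \<C> \<noteq> {} \<Longrightarrow> (\<And>C. C \<in> \<C> \<Longrightarrow> openin X C) \<Longrightarrow>
       (\<And>C D. C \<in> \<C> \<Longrightarrow> D \<in> \<C> \<Longrightarrow> C \<subseteq> D \<or> D \<subseteq> C) \<Longrightarrow> S \<in> \<S> \<Longrightarrow> S \<subseteq> \<Union>\<C> \<Longrightarrow>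
       \<exists>T\<in>\<S>. \<exists>C\<in>\<C>. T \<subseteq> C"
  shows "\<exists>M. maximal_open_avoiding X U \<S> M"
proof -
  define \<A> where "\<A> = {W. openin X W \<and> U \<subseteq> W \<and> (\<forall>S\<in>\<S>. \<not> S \<subseteq> W)}"
  have "\<exists>M\<in>\<A>. \<forall>W\<in>\<A>. M \<subseteq> W \<longrightarrow> W = M"
  proof (rule subset_Zorn_nonempty)
    have "U \<in> \<A>" using U by (simp add: \<A>_def)
    then show "\<A> \<noteq> {}" by auto
    fix \<C> assume ne: "\<C> \<noteq> {}" and C: "subset.chain \<A> \<C>"
    have CA: "\<C> \<subseteq> \<A>" and lin: "\<And>C D. C \<in> \<C> \<Longrightarrow> D \<in> \<C> \<Longrightarrow> C \<subseteq> D \<or> D \<subseteq> C"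
      using C by (auto simp: subset_chain_def)
    have op: "\<And>C. C \<in> \<C> \<Longrightarrow> openin X C" using CA by (auto simp: \<A>_def)
    have "\<not> S \<subseteq> \<Union>\<C>" if S: "S \<in> \<S>" for S
    proof
      assume sub: "S \<subseteq> \<Union>\<C>"
      have "\<exists>T\<in>\<S>. \<exists>C\<in>\<C>. T \<subseteq> C" by (rule chain[OF ne]) (fact op lin S sub)+
      then show False using CA by (auto simp: \<A>_def)
    qed
    moreover have "U \<subseteq> \<Union>\<C>"
    proof -
      obtain C where "C \<in> \<C>" using ne by auto
      then have "U \<subseteq> C" "C \<subseteq> \<Union>\<C>" using CA by (auto simp: \<A>_def)
      then show ?thesis by (rule order_trans)
    qed
    ultimately show "\<Union>\<C> \<in> \<A>" using op by (simp add: \<A>_def openin_Union)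
  qed
  then obtain M where M: "M \<in> \<A>" and max: "\<And>W. W \<in> \<A> \<Longrightarrow> M \<subseteq> W \<Longrightarrow> W = M" by auto
  have MM: "openin X M" "U \<subseteq> M" "\<forall>S\<in>\<S>. \<not> S \<subseteq> M"
    using M by (auto simp: \<A>_def)
  have "\<exists>S\<in>\<S>. S \<subseteq> M \<union> G" if G: "openin X G" "\<not> G \<subseteq> M" for G
  proof (rule ccontr)
    assume "\<not> ?thesis"
    then have "M \<union> G \<in> \<A>"
      using MM(1,2) G(1) by (simp add: \<A>_def openin_Un le_supI1)
    then have "M \<union> G = M" by (rule max) simp
    then show False using G(2) by auto
  qed
  then show ?thesis
    unfolding maximal_open_avoiding_def using MM by (intro exI[of _ M]) simp
qed

section \<open>The way-below relation between open sets\<close>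

definition open_directed :: "'a topology \<Rightarrow> 'a set set \<Rightarrow> bool" where
  "open_directed X \<D> \<longleftrightarrow> \<D> \<noteq> {} \<and> (\<forall>D\<in>\<D>. openin X D) \<and> (\<forall>A\<in>\<D>. \<forall>B\<in>\<D>. \<exists>C\<in>\<D>. A \<union> B \<subseteq> C)"

lemma directed_in_open_set_lattice:
  "directed_in (open_set_lattice X) \<D> \<longleftrightarrow> open_directed X \<D>"
  by (auto simp: directed_in_def open_directed_def open_set_lattice_def)

lemma least_open_set_lattice:
  assumes "\<And>D. D \<in> \<D> \<Longrightarrow> openin X D"
  shows "least (open_set_lattice X) s (Upper (open_set_lattice X) \<D>) \<longleftrightarrow> s = \<Union>\<D>"
proof
  have U: "\<Union>\<D> \<in> Upper (open_set_lattice X) \<D>"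
    using assms by (auto simp: Upper_def open_set_lattice_def openin_Union)
  show "least (open_set_lattice X) s (Upper (open_set_lattice X) \<D>)" if "s = \<Union>\<D>"
    unfolding that least_def
  proof (intro conjI ballI U)
    show "Upper (open_set_lattice X) \<D> \<subseteq> carrier (open_set_lattice X)"
      by (auto simp: Upper_def)
    show "\<Union>\<D> \<sqsubseteq>\<^bsub>open_set_lattice X\<^esub> y" if "y \<in> Upper (open_set_lattice X) \<D>" for y
      using that assms by (auto simp: Upper_def open_set_lattice_def)
  qed
  assume s: "least (open_set_lattice X) s (Upper (open_set_lattice X) \<D>)"
  then have "s \<subseteq> \<Union>\<D>" using U by (simp add: least_def open_set_lattice_def)
  moreover have "\<Union>\<D> \<subseteq> s"
    using s assms by (auto simp: least_def Upper_def open_set_lattice_def)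
  ultimately show "s = \<Union>\<D>" by (rule subset_antisym)
qed

abbreviation open_way_below :: "'a topology \<Rightarrow> 'a set \<Rightarrow> 'a set \<Rightarrow> bool" where
  "open_way_below X \<equiv> way_below (open_set_lattice X)"

lemma open_way_below_iff:
  "open_way_below X V U \<longleftrightarrow> openin X V \<and> openin X U \<and>
     (\<forall>\<D>. open_directed X \<D> \<and> U \<subseteq> \<Union>\<D> \<longrightarrow> (\<exists>D\<in>\<D>. V \<subseteq> D))"
proof -
  have "directed_in (open_set_lattice X) \<D> \<and>
      least (open_set_lattice X) s (Upper (open_set_lattice X) \<D>) \<longleftrightarrow>
      open_directed X \<D> \<and> s = \<Union>\<D>" for \<D> s
    using least_open_set_lattice[of \<D> X s]
    by (auto simp: directed_in_open_set_lattice open_directed_def)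
  then show ?thesis
    unfolding way_below_def conj_assoc[symmetric] by (simp add: open_set_lattice_def)
qed

lemma open_way_belowD:
  assumes "open_way_below X V U" "open_directed X \<D>" "U \<subseteq> \<Union>\<D>"
  shows "\<exists>D\<in>\<D>. V \<subseteq> D"
  using assms unfolding open_way_below_iff by simp

lemma open_way_below_openin: "open_way_below X V U \<Longrightarrow> openin X V \<and> openin X U"
  by (simp add: open_way_below_iff)

lemma open_way_below_subset:
  assumes "open_way_below X V U"
  shows "V \<subseteq> U"
  using open_way_belowD[OF assms, of "{U}"] open_way_below_openin[OF assms]
  by (simp add: open_directed_def)

lemma open_way_below_mono:
  assumes "open_way_below X V U" "openin X V'" "V' \<subseteq> V" "openin X U'" "U \<subseteq> U'"
  shows "open_way_below X V' U'"
  unfolding open_way_below_iff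
proof (intro conjI allI impI assms(2,4), elim conjE)
  fix \<D> assume "open_directed X \<D>" "U' \<subseteq> \<Union>\<D>"
  then have "\<exists>D\<in>\<D>. V \<subseteq> D" using assms(1,5) open_way_belowD[of X V U \<D>] by simp
  then show "\<exists>D\<in>\<D>. V' \<subseteq> D" using assms(3) by (meson order_trans)
qed

lemma core_compact_way_below:
  assumes X: "core_compact_space X" and U: "openin X U"
  shows "open_directed X {V. open_way_below X V U}" "\<Union>{V. open_way_below X V U} = U"
proof -
  have "\<forall>x\<in>carrier (open_set_lattice X).
      directed_in (open_set_lattice X) {y. open_way_below X y x} \<and>
      least (open_set_lattice X) x (Upper (open_set_lattice X) {y. open_way_below X y x})"
    using X unfolding core_compact_space_def continuous_lattice_def by simp
  moreover have "U \<in> carrier (open_set_lattice X)" using U by (simp add: open_set_lattice_def)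
  ultimately have "directed_in (open_set_lattice X) {V. open_way_below X V U} \<and>
      least (open_set_lattice X) U (Upper (open_set_lattice X) {V. open_way_below X V U})"
    by (rule bspec)
  then show "open_directed X {V. open_way_below X V U}" "\<Union>{V. open_way_below X V U} = U"
    using least_open_set_lattice[of "{V. open_way_below X V U}" X U]
    by (simp_all add: directed_in_open_set_lattice open_way_below_openin)
qed

text \<open>The open sets that reach \<open>U\<close> in two way-below steps are directed, and
  applying core-compactness twice shows that they cover \<open>U\<close>. As \<open>V\<close> is way
  below \<open>U\<close>, it lies in one of them, and the intermediate set of that one
  interpolates.\<close>

lemma open_way_below_interpolation:
  assumes X: "core_compact_space X" and VU: "open_way_below X V U"
  shows "\<exists>W. open_way_below X V W \<and> open_way_below X W U"
proof -
  define \<D> where "\<D> = {Y. \<exists>W. open_way_below X Y W \<and> open_way_below X W U}"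
  have U: "openin X U" using open_way_below_openin[OF VU] by simp
  note dir = core_compact_way_below(1)[OF X]
  have "open_directed X \<D>"
    unfolding open_directed_def
  proof (intro conjI ballI)
    obtain W where W: "open_way_below X W U" using VU by auto
    then have "open_directed X {Y. open_way_below X Y W}"
      using dir open_way_below_openin by metis
    then obtain Y where "open_way_below X Y W" by (auto simp: open_directed_def)
    then show "\<D> \<noteq> {}" using W by (auto simp: \<D>_def)
    show "openin X Y" if "Y \<in> \<D>" for Y
      using that open_way_below_openin by (auto simp: \<D>_def)
    fix A B assume "A \<in> \<D>" "B \<in> \<D>"
    then obtain A' B' where A': "open_way_below X A A'" "open_way_below X A' U"
      and B': "open_way_below X B B'" "open_way_below X B' U"
      by (auto simp: \<D>_def)
    have "\<exists>W\<in>{W. open_way_below X W U}. A' \<union> B' \<subseteq> W"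
      using dir[OF U] A'(2) B'(2) by (simp add: open_directed_def)
    then obtain W where W: "open_way_below X W U" "A' \<subseteq> W" "B' \<subseteq> W" by auto
    have Wo: "openin X W" using open_way_below_openin[OF W(1)] by simp
    have "open_way_below X A W" "open_way_below X B W"
      using open_way_below_mono[OF A'(1) _ order_refl Wo W(2)]
        open_way_below_mono[OF B'(1) _ order_refl Wo W(3)]
        open_way_below_openin[OF A'(1)] open_way_below_openin[OF B'(1)] by simp_all
    then have "\<exists>C\<in>{C. open_way_below X C W}. A \<union> B \<subseteq> C"
      using dir[OF Wo] by (simp add: open_directed_def)
    then show "\<exists>C\<in>\<D>. A \<union> B \<subseteq> C" using W(1) by (auto simp: \<D>_def)
  qed
  moreover have "U \<subseteq> \<Union>\<D>"
  proof
    fix x assume "x \<in> U"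
    then have "x \<in> \<Union>{V. open_way_below X V U}" using core_compact_way_below(2)[OF X U] by simp
    then obtain W where W: "open_way_below X W U" "x \<in> W" by auto
    then have "x \<in> \<Union>{V. open_way_below X V W}"
      using core_compact_way_below(2)[OF X, of W] open_way_below_openin[OF W(1)] by simp
    then show "x \<in> \<Union>\<D>" using W(1) by (auto simp: \<D>_def)
  qed
  ultimately obtain Y where "Y \<in> \<D>" "V \<subseteq> Y" using open_way_belowD[OF VU] by meson
  then obtain W where W: "open_way_below X Y W" "open_way_below X W U" by (auto simp: \<D>_def)
  have "open_way_below X V W"
    using open_way_below_mono[OF W(1) _ \<open>V \<subseteq> Y\<close> _ order_refl]
      open_way_below_openin[OF VU] open_way_below_openin[OF W(1)] by simp
  then show ?thesis using W(2) by auto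
qed

text \<open>A Hofmann-Mislove argument for countable chains. Every open set that meets the sequence
  \<open>a\<close> of points outside a maximal \<open>M\<close> contains almost all of it, so its tails are compact.\<close>

lemma open_way_below_sequence_Inter:
  assumes X: "well_filtered_space X"
    and f: "\<And>n. open_way_below X (f (Suc n)) (f n)"
    and W: "openin X W" "\<Inter>(range f) \<subseteq> W"
  shows "\<exists>n. f n \<subseteq> W"
proof (rule ccontr)
  assume neg: "\<not> ?thesis"
  have fo: "openin X (f n)" for n using open_way_below_openin[OF f] by simp
  have dec: "decseq f" using open_way_below_subset[OF f] by (simp add: decseq_Suc_iff)
  have W': "\<not> S \<subseteq> W" if "S \<in> range f" for S using that neg by auto
  \<comment> \<open>A nonempty chain of open sets is directed, so a member of it that need not
    contain \<open>f n\<close> contains \<open>f (Suc n)\<close>.\<close>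
  have chain: "\<exists>T\<in>range f. \<exists>C\<in>\<C>. T \<subseteq> C"
    if C: "\<C> \<noteq> {}" "\<And>C. C \<in> \<C> \<Longrightarrow> openin X C" "\<And>C D. C \<in> \<C> \<Longrightarrow> D \<in> \<C> \<Longrightarrow> C \<subseteq> D \<or> D \<subseteq> C"
      and S: "S \<in> range f" "S \<subseteq> \<Union>\<C>" for \<C> S
  proof -
    obtain n where n: "S = f n" using S(1) by auto
    have "\<exists>E\<in>\<C>. C \<union> D \<subseteq> E" if "C \<in> \<C>" "D \<in> \<C>" for C D
      using C(3)[of C D] that by (metis Un_absorb1 Un_absorb2 order_refl)
    then have "open_directed X \<C>" using C(1,2) by (simp add: open_directed_def)
    then have "\<exists>C\<in>\<C>. f (Suc n) \<subseteq> C" using open_way_belowD[OF f[of n]] S(2) n by simp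
    then show ?thesis by auto
  qed
  have "\<exists>M. maximal_open_avoiding X W (range f) M"
    by (rule maximal_open_exists[OF W(1)]) (fact W', fact chain)
  then obtain M where MW: "maximal_open_avoiding X W (range f) M" by (rule exE)
  have M: "openin X M" "W \<subseteq> M" "\<And>S. S \<in> range f \<Longrightarrow> \<not> S \<subseteq> M"
    and max: "\<And>G. openin X G \<Longrightarrow> \<not> G \<subseteq> M \<Longrightarrow> \<exists>S\<in>range f. S \<subseteq> M \<union> G"
    using MW by (simp_all only: maximal_open_avoiding_def) auto
  have "\<exists>x. x \<in> f n \<and> x \<notin> M" for n using M(3)[of "f n"] by auto
  then obtain a where a: "\<And>n. a n \<in> f n" "\<And>n. a n \<notin> M" by metis
  \<comment> \<open>An open \<open>G\<close> containing \<open>a k\<close> is not inside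
    \<open>M\<close>, so some \<open>f N\<close> lies in \<open>M \<union> G\<close>; from
    \<open>N\<close> on, the points are in \<open>f N\<close> but outside \<open>M\<close>, hence in
    \<open>G\<close>.\<close>
  have cofinite: "\<exists>N. \<forall>m\<ge>N. a m \<in> G" if G: "openin X G" "a k \<in> G" for G k
  proof -
    have "\<not> G \<subseteq> M" using G(2) a(2) by auto
    then obtain N where N: "f N \<subseteq> M \<union> G" using max[OF G(1)] by auto
    have "a m \<in> G" if "N \<le> m" for m
      using decseqD[OF dec that] a(1)[of m] a(2)[of m] N by auto
    then show ?thesis by auto
  qed
  have comp: "compactin X (a ` {n..})" for n
    unfolding compactin_def
  proof (intro conjI allI impI)
    show "a ` {n..} \<subseteq> topspace X" using a(1) fo openin_subset by fastforce
    fix \<V> assume V: "Ball \<V> (openin X) \<and> a ` {n..} \<subseteq> \<Union>\<V>"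
    then have "\<exists>G. G \<in> \<V> \<and> a m \<in> G" if "n \<le> m" for m using that by auto
    then obtain g where g: "\<And>m. n \<le> m \<Longrightarrow> g m \<in> \<V> \<and> a m \<in> g m" by metis
    \<comment> \<open>The cover member through \<open>a n\<close> captures all indices from
      \<open>N\<close> on. The bound \<open>max n N\<close> keeps \<open>n\<close> itself in the
      finite index range even when \<open>N < n\<close>.\<close>
    obtain N where N: "\<forall>m\<ge>N. a m \<in> g n" using cofinite[of "g n" n] g[of n] V by auto
    have "a m \<in> \<Union>(g ` {n..max n N})" if "n \<le> m" for m
    proof (cases "m \<le> N")
      case True
      then show ?thesis using g[OF that] that by (intro UN_I[of m]) auto
    next
      case False
      then show ?thesis using N by (intro UN_I[of n]) auto
    qed
    then show "\<exists>\<F>. finite \<F> \<and> \<F> \<subseteq> \<V> \<and> a ` {n..} \<subseteq> \<Union>\<F>"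
      using g by (intro exI[of _ "g ` {n..max n N}"]) auto
  qed
  define K where "K n = saturation X (a ` {n..})" for n
  have "range K \<subseteq> Q_sets X"
    unfolding K_def using saturation_in_Q_sets[OF comp] by auto
  moreover have "decseq K"
    unfolding decseq_def K_def saturation_def by (intro allI impI Inter_anti_mono) (auto simp: subset_iff)
  \<comment> \<open>Each \<open>f n\<close> is open and contains the tail from \<open>n\<close>, so
    it also contains the saturation \<open>K n\<close>.\<close>
  moreover have "\<Inter>(range K) \<subseteq> M"
  proof -
    have "K n \<subseteq> f n" for n
      unfolding K_def saturation_subset_iff[OF fo]
    proof (rule image_subsetI)
      fix m assume "m \<in> {n..}"
      then have "f m \<subseteq> f n" using decseqD[OF dec, of n m] by simp
      then show "a m \<in> f n" using a(1)[of m] by (rule subsetD)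
    qed
    then have "\<Inter>(range K) \<subseteq> \<Inter>(range f)" by (intro INT_anti_mono) auto
    then show ?thesis using W(2) M(2) by (meson order_trans)
  qed
  ultimately obtain n where "K n \<subseteq> M"
    using well_filtered_Q_sets[OF X _ filtered_family_range_decseq[of K] M(1)] by auto
  moreover have "a n \<in> K n" unfolding K_def using subset_saturation[of "a ` {n..}" X] by auto
  ultimately show False using a(2)[of n] by auto
qed

text \<open>Interpolating repeatedly between \<open>V\<close> and \<open>U\<close> gives a
  descending way-below sequence whose intersection contains the open set \<open>V\<close>. An open
  cover of the intersection already covers some \<open>f n\<close>, and the next term, being way
  below \<open>f n\<close>, needs only finitely many members.\<close>

lemma locally_compact_if_core_compact:
  assumes X: "core_compact_space X" "well_filtered_space X"
  shows "locally_compact_T0 X"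
  unfolding locally_compact_T0_def
proof (intro conjI allI impI)
  show "t0_space X" using X(1) by (simp add: core_compact_space_def)
  fix x U assume xU: "openin X U \<and> x \<in> U"
  then have "x \<in> \<Union>{V. open_way_below X V U}" using core_compact_way_below(2)[OF X(1)] by simp
  then obtain V where V: "open_way_below X V U" "x \<in> V" by auto
  \<comment> \<open>Each new term interpolates between \<open>V\<close> and the current one; the
    clause for \<open>n = 0\<close> anchors the sequence at \<open>U\<close>.\<close>
  have "\<exists>f. \<forall>n. (open_way_below X V (f n) \<and> (n = 0 \<longrightarrow> f n = U)) \<and> open_way_below X (f (Suc n)) (f n)"
    by (rule dependent_nat_choice) (use V(1) open_way_below_interpolation[OF X(1)] in auto)
  then obtain f where f: "\<And>n. open_way_below X V (f n)" "f 0 = U"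
    "\<And>n. open_way_below X (f (Suc n)) (f n)" by metis
  define Q where "Q = \<Inter>(range f)"
  have Qf: "Q \<subseteq> f n" for n unfolding Q_def by auto
  have "compactin X Q"
    unfolding compactin_def
  proof (intro conjI allI impI)
    show "Q \<subseteq> topspace X"
      using Qf[of 0] f(2) xU openin_subset[of X U] by auto
    fix \<V> assume \<V>: "Ball \<V> (openin X) \<and> Q \<subseteq> \<Union>\<V>"
    have "openin X (\<Union>\<V>)" using \<V> by (simp add: openin_Union)
    then obtain n where n: "f n \<subseteq> \<Union>\<V>"
      using open_way_below_sequence_Inter[of X f "\<Union>\<V>", OF X(2) f(3)] \<V> Q_def by auto
    \<comment> \<open>Finite unions turn the cover into a directed family, the form that the
      way-below relation accepts.\<close>
    define \<D> where "\<D> = Union ` {\<F>. finite \<F> \<and> \<F> \<subseteq> \<V>}"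
    have "open_directed X \<D>"
      unfolding open_directed_def
    proof (intro conjI ballI)
      show "\<D> \<noteq> {}" unfolding \<D>_def by auto
      show "openin X D" if "D \<in> \<D>" for D
        using that \<V> by (auto simp: \<D>_def)
      fix A B assume "A \<in> \<D>" "B \<in> \<D>"
      then obtain \<F> \<G> where "A = \<Union>\<F>" "finite \<F>" "\<F> \<subseteq> \<V>" "B = \<Union>\<G>" "finite \<G>" "\<G> \<subseteq> \<V>"
        unfolding \<D>_def by auto
      then show "\<exists>C\<in>\<D>. A \<union> B \<subseteq> C"
        unfolding \<D>_def by (intro bexI[of _ "\<Union>(\<F> \<union> \<G>)"] imageI) auto
    qed
    moreover have "\<Union>\<V> \<subseteq> \<Union>\<D>"
    proof
      fix y assume "y \<in> \<Union>\<V>"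
      then obtain B where "B \<in> \<V>" "y \<in> B" by auto
      have "\<Union>{B} \<in> \<D>" unfolding \<D>_def by (rule imageI) (simp add: \<open>B \<in> \<V>\<close>)
      then show "y \<in> \<Union>\<D>" by (rule UnionI) (simp add: \<open>y \<in> B\<close>)
    qed
    ultimately have D: "\<exists>D\<in>\<D>. f (Suc n) \<subseteq> D"
      by (intro open_way_belowD[OF f(3)[of n]] order_trans[OF n])
    then obtain \<F> where "finite \<F>" "\<F> \<subseteq> \<V>" "f (Suc n) \<subseteq> \<Union>\<F>"
      unfolding \<D>_def by auto
    then show "\<exists>\<F>. finite \<F> \<and> \<F> \<subseteq> \<V> \<and> Q \<subseteq> \<Union>\<F>"
      using Qf[of "Suc n"] by (meson order_trans)
  qed
  moreover have "V \<subseteq> Q" unfolding Q_def using open_way_below_subset[OF f(1)] by (simp add: INT_greatest)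
  then have "V \<subseteq> X interior_of Q"
    using open_way_below_openin[OF V(1)] by (simp add: interior_of_maximal)
  then have "x \<in> X interior_of Q" using V(2) by auto
  moreover have "Q \<subseteq> U" using Qf[of 0] f(2) by simp
  ultimately show "\<exists>K. compactin X K \<and> x \<in> X interior_of K \<and> K \<subseteq> U" by auto
qed


section \<open>Sources of countable neighbourhood bases\<close>

text \<open>A countable family has only countably many finite unions, and compactness of
  \<open>K\<close> extracts one of these between \<open>K\<close> and a given open set.\<close>

lemma countable_base_at_compact:
  assumes K: "compactin X K" and B: "countable \<B>" "\<And>B. B \<in> \<B> \<Longrightarrow> openin X B"
    and nb: "\<And>V x. openin X V \<Longrightarrow> K \<subseteq> V \<Longrightarrow> x \<in> K \<Longrightarrow> \<exists>B\<in>\<B>. x \<in> B \<and> B \<subseteq> V"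
  shows "countable_base_at X K"
  unfolding countable_base_at_def
proof (intro exI conjI ballI allI impI)
  let ?\<C> = "{U \<in> Union ` {\<F>. finite \<F> \<and> \<F> \<subseteq> \<B>}. K \<subseteq> U}"
  have "countable {\<F>. finite \<F> \<and> \<F> \<subseteq> \<B>}" by (rule countable_Collect_finite_subset[OF B(1)])
  then have "countable (Union ` {\<F>. finite \<F> \<and> \<F> \<subseteq> \<B>})" by (rule countable_image)
  then show "countable ?\<C>" by (rule countable_subset[rotated]) auto
  show "openin X U" if "U \<in> ?\<C>" for U using that B(2) by (auto intro!: openin_Union)
  show "K \<subseteq> U" if "U \<in> ?\<C>" for U using that by simp
  fix V assume "openin X V \<and> K \<subseteq> V"
  then have V: "openin X V" "K \<subseteq> V" by simp_all
  have "K \<subseteq> \<Union>{B \<in> \<B>. B \<subseteq> V}" using nb[OF V] by fastforce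
  moreover have "\<And>B. B \<in> {B \<in> \<B>. B \<subseteq> V} \<Longrightarrow> openin X B" using B(2) by simp
  ultimately have "\<exists>\<F>. finite \<F> \<and> \<F> \<subseteq> {B \<in> \<B>. B \<subseteq> V} \<and> K \<subseteq> \<Union>\<F>"
    using K unfolding compactin_def by simp
  then obtain \<F> where F: "finite \<F>" "\<F> \<subseteq> {B \<in> \<B>. B \<subseteq> V}" "K \<subseteq> \<Union>\<F>" by auto
  then have "\<Union>\<F> \<in> ?\<C>" by auto
  moreover have "\<Union>\<F> \<subseteq> V" using F(2) by auto
  ultimately show "\<exists>U\<in>?\<C>. U \<subseteq> V" by (rule bexI[rotated])
qed

lemma countable_base_at_second_countable:
  assumes "second_countable X" "compactin X K"
  shows "countable_base_at X K"
proof -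
  obtain \<B> where \<B>: "countable \<B>" "\<And>B. B \<in> \<B> \<Longrightarrow> openin X B"
    "\<And>U x. openin X U \<Longrightarrow> x \<in> U \<Longrightarrow> \<exists>B\<in>\<B>. x \<in> B \<and> B \<subseteq> U"
    using assms(1) unfolding second_countable_def by auto
  show ?thesis
    by (rule countable_base_at_compact[OF assms(2) \<B>(1,2)]) (use \<B>(3) in auto)
qed

text \<open>Every point of \<open>K\<close> lies above some \<open>c\<close> in \<open>C\<close>, so
  a basic neighbourhood of \<open>c\<close> contains that point as well. The local bases at the
  points of \<open>C\<close> therefore suffice for all of \<open>K\<close>.\<close>

lemma countable_base_at_countable_generators:
  assumes X: "first_countable X" and K: "compactin X K"
    and C: "countable C" "C \<subseteq> K" "\<And>x. x \<in> K \<Longrightarrow> \<exists>c\<in>C. \<forall>U. openin X U \<and> c \<in> U \<longrightarrow> x \<in> U"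
  shows "countable_base_at X K"
proof -
  have "\<exists>\<B>. countable \<B> \<and> (\<forall>V\<in>\<B>. openin X V) \<and>
      (\<forall>U. openin X U \<and> c \<in> U \<longrightarrow> (\<exists>V\<in>\<B>. c \<in> V \<and> V \<subseteq> U))" if "c \<in> C" for c
  proof -
    have "c \<in> topspace X" using that C(2) compactin_subset_topspace[OF K] by auto
    then show ?thesis using X unfolding first_countable_def by (rule bspec[rotated])
  qed
  then obtain b where b: "\<And>c. c \<in> C \<Longrightarrow> countable (b c)" "\<And>c V. c \<in> C \<Longrightarrow> V \<in> b c \<Longrightarrow> openin X V"
    "\<And>c U. c \<in> C \<Longrightarrow> openin X U \<Longrightarrow> c \<in> U \<Longrightarrow> \<exists>V\<in>b c. c \<in> V \<and> V \<subseteq> U"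
    by metis
  show ?thesis
  proof (rule countable_base_at_compact[OF K])
    show "countable (\<Union>(b ` C))" using C(1) b(1) by auto
    show "openin X B" if "B \<in> \<Union>(b ` C)" for B using that b(2) by auto
    fix V x assume V: "openin X V" "K \<subseteq> V" and x: "x \<in> K"
    obtain c where c: "c \<in> C" "\<forall>U. openin X U \<and> c \<in> U \<longrightarrow> x \<in> U" using C(3)[OF x] by auto
    have "c \<in> V" using c(1) C(2) V(2) by auto
    then obtain B where B: "B \<in> b c" "c \<in> B" "B \<subseteq> V" using b(3)[OF c(1) V(1)] by auto
    then have "x \<in> B" using c(2) b(2)[OF c(1) B(1)] by simp
    then show "\<exists>B\<in>\<Union>(b ` C). x \<in> B \<and> B \<subseteq> V" using B c(1) by auto
  qed
qed

text \<open>Each basic neighbourhood of \<open>K\<close> in the power space is shrunk to the box of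
  an open set. Inclusion of boxes reflects to inclusion of open sets when it is tested on
  saturations of single points.\<close>

lemma countable_base_at_first_countable_smyth:
  assumes X: "first_countable (smyth_power_space X)" and K: "K \<in> Q_sets X"
  shows "countable_base_at X K"
proof -
  have "\<exists>\<B>. countable \<B> \<and> (\<forall>V\<in>\<B>. openin (smyth_power_space X) V) \<and>
      (\<forall>U. openin (smyth_power_space X) U \<and> K \<in> U \<longrightarrow> (\<exists>V\<in>\<B>. K \<in> V \<and> V \<subseteq> U))"
    using X[unfolded first_countable_def topspace_smyth_power_space] K by (rule bspec)
  then obtain \<B> where \<B>: "countable \<B>" "\<And>V. V \<in> \<B> \<Longrightarrow> openin (smyth_power_space X) V"
    "\<And>U. openin (smyth_power_space X) U \<Longrightarrow> K \<in> U \<Longrightarrow> \<exists>V\<in>\<B>. K \<in> V \<and> V \<subseteq> U"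
    by metis
  define \<B>' where "\<B>' = {B \<in> \<B>. K \<in> B}"
  have "\<exists>U. openin X U \<and> K \<subseteq> U \<and> upper_box X U \<subseteq> B" if "B \<in> \<B>'" for B
  proof -
    have "openin (smyth_power_space X) B" "K \<in> B" using that \<B>(2) by (auto simp: \<B>'_def)
    then show ?thesis using openin_smythE by metis
  qed
  then obtain u where u: "\<And>B. B \<in> \<B>' \<Longrightarrow> openin X (u B) \<and> K \<subseteq> u B \<and> upper_box X (u B) \<subseteq> B"
    by metis
  have "\<exists>U\<in>u ` \<B>'. U \<subseteq> V" if V: "openin X V" "K \<subseteq> V" for V
  proof -
    have "K \<in> upper_box X V" using K V(2) by (simp add: in_upper_box_iff)
    then obtain B where B: "B \<in> \<B>" "K \<in> B" "B \<subseteq> upper_box X V"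
      using \<B>(3)[OF openin_upper_box[OF V(1)]] by auto
    then have B': "B \<in> \<B>'" by (simp add: \<B>'_def)
    have "x \<in> V" if x: "x \<in> u B" for x
    proof -
      have "x \<in> topspace X" using x u[OF B'] openin_subset by fastforce
      then have "saturation X {x} \<in> Q_sets X" by (simp add: saturation_in_Q_sets)
      moreover have "saturation X {x} \<subseteq> u B" using u[OF B'] x by (simp add: saturation_subset_iff)
      ultimately have "saturation X {x} \<in> upper_box X (u B)" by (simp add: in_upper_box_iff)
      then have "saturation X {x} \<in> upper_box X V" using u[OF B'] B(3) by auto
      then show "x \<in> V" using subset_saturation[of "{x}" X] by (auto simp: in_upper_box_iff)
    qed
    then show ?thesis using B' by auto
  qed
  moreover have "countable (u ` \<B>')" using \<B>(1) unfolding \<B>'_def by simp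
  ultimately show ?thesis unfolding countable_base_at_def using u by (intro exI[of _ "u ` \<B>'"]) auto
qed

section \<open>Minimal points of compact sets\<close>

lemma specialization_le_iff:
  assumes "x \<in> topspace X"
  shows "specialization_le X x y \<longleftrightarrow> (\<forall>U. openin X U \<and> x \<in> U \<longrightarrow> y \<in> U)"
  using assms by (auto simp: specialization_le_def in_closure_of)

lemma t0_specialization_antisym:
  assumes "t0_space X" "x \<in> topspace X" "y \<in> topspace X"
    "specialization_le X x y" "specialization_le X y x"
  shows "x = y"
  using assms by (auto simp: t0_space_def specialization_le_iff)

text \<open>Zorn's lemma is applied to complements of point closures: these are open, so compactness
  handles chains, and a maximal complement is a minimal closure.\<close>

lemma minimal_point_below:
  assumes X: "t0_space X" and K: "compactin X K" and y: "y \<in> K"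
  shows "\<exists>m\<in>minimal_points X K. specialization_le X m y"
proof -
  have Kt: "K \<subseteq> topspace X" by (rule compactin_subset_topspace[OF K])
  define C where "C z = X closure_of {z}" for z
  define K' where "K' = C y \<inter> K"
  define \<A> where "\<A> = (\<lambda>z. topspace X - C z) ` K'"
  have yK': "y \<in> K'" using y Kt by (auto simp: K'_def C_def in_closure_of)
  have K': "compactin X K'" unfolding K'_def C_def using K by (intro closed_Int_compactin) auto
  have mem: "z \<in> C z" if "z \<in> K" for z using that Kt by (auto simp: C_def in_closure_of)
  have sub: "C w \<subseteq> C z" if "w \<in> C z" for w z
    using that unfolding C_def by (intro closure_of_minimal) auto
  have op: "openin X A" if "A \<in> \<A>" for A using that by (auto simp: \<A>_def C_def)
  have "\<exists>M\<in>\<A>. \<forall>A\<in>\<A>. M \<subseteq> A \<longrightarrow> A = M"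
  proof (rule subset_Zorn)
    fix \<C> assume \<C>: "subset.chain \<A> \<C>"
    \<comment> \<open>Otherwise a finite subchain, and so its largest member, would cover
      \<open>K'\<close>; but the complement of \<open>C z\<close> misses the point \<open>z\<close>
      of \<open>K'\<close>. A point left uncovered lies below all points that index the
      chain.\<close>
    have "\<not> K' \<subseteq> \<Union>\<C>"
    proof
      assume "K' \<subseteq> \<Union>\<C>"
      moreover have "\<And>A. A \<in> \<C> \<Longrightarrow> openin X A" using \<C> op by (auto simp: subset_chain_def)
      ultimately have "\<exists>\<F>. finite \<F> \<and> \<F> \<subseteq> \<C> \<and> K' \<subseteq> \<Union>\<F>"
        using K' unfolding compactin_def by simp
      then obtain \<F> where F: "finite \<F>" "\<F> \<subseteq> \<C>" "K' \<subseteq> \<Union>\<F>" by auto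
      have "\<F> \<noteq> {}" using F(3) yK' by auto
      moreover have "\<C> \<subseteq> \<A>" "\<forall>A\<in>\<C>. \<forall>B\<in>\<C>. A \<subseteq> B \<or> B \<subseteq> A"
        using \<C> by (simp_all add: subset_chain_def)
      then have "subset.chain \<A> \<F>"
        unfolding subset_chain_def using F(2) by (meson order_trans subsetD)
      ultimately have "\<Union>\<F> \<in> \<F>" using F(1) by (intro Union_in_chain)
      then have "\<Union>\<F> \<in> \<A>" using F(2) \<C> by (auto simp: subset_chain_def)
      then obtain z where z: "z \<in> K'" "\<Union>\<F> = topspace X - C z" by (auto simp: \<A>_def)
      then show False using F(3) mem[of z] by (auto simp: K'_def)
    qed
    then obtain w where w: "w \<in> K'" "w \<notin> \<Union>\<C>" by auto
    have "A \<subseteq> topspace X - C w" if A: "A \<in> \<C>" for A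
    proof -
      obtain z where z: "A = topspace X - C z" using A \<C> by (auto simp: subset_chain_def \<A>_def)
      then have "w \<in> C z" using w A Kt by (auto simp: K'_def)
      then show ?thesis using sub z by auto
    qed
    then show "\<exists>U\<in>\<A>. \<forall>A\<in>\<C>. A \<subseteq> U" using w(1) by (auto simp: \<A>_def)
  qed
  then obtain M where M: "M \<in> \<A>" "\<And>A. A \<in> \<A> \<Longrightarrow> M \<subseteq> A \<Longrightarrow> A = M" by auto
  then obtain m where m: "m \<in> K'" "M = topspace X - C m" by (auto simp: \<A>_def)
  have mK: "m \<in> K" "m \<in> C y" using m(1) by (auto simp: K'_def)
  have "z = m" if z: "z \<in> K" "specialization_le X z m" for z
  proof -
    have zm: "z \<in> C m" using z(2) by (simp add: specialization_le_def C_def)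
    have "z \<in> C y" using zm sub[OF mK(2)] by auto
    then have "topspace X - C z \<in> \<A>" using z(1) by (auto simp: \<A>_def K'_def)
    moreover have "M \<subseteq> topspace X - C z" using sub[OF zm] m(2) by auto
    ultimately have "topspace X - C z = M" by (rule M(2))
    then have "m \<in> C z" using mem[OF mK(1)] m(2) mK(1) Kt by auto
    then have "specialization_le X m z" by (simp add: specialization_le_def C_def)
    then show "z = m"
      using t0_specialization_antisym[OF X, of z m] z Kt mK(1) by auto
  qed
  then have "m \<in> minimal_points X K" using mK(1) by (simp add: minimal_points_def)
  moreover have "specialization_le X m y" using mK(2) by (simp add: specialization_le_def C_def)
  ultimately show ?thesis by (rule bexI[rotated])
qed

lemma countable_base_at_minimal_points:
  assumes X: "t0_space X" "first_countable X" and K: "compactin X K"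
    and m: "countable (minimal_points X K)"
  shows "countable_base_at X K"
proof (rule countable_base_at_countable_generators[OF X(2) K m])
  show sub: "minimal_points X K \<subseteq> K" by (auto simp: minimal_points_def)
  fix y assume "y \<in> K"
  then obtain m where m: "m \<in> minimal_points X K" "specialization_le X m y"
    using minimal_point_below[OF X(1) K] by auto
  then have "m \<in> topspace X" using sub compactin_subset_topspace[OF K] by auto
  then show "\<exists>c\<in>minimal_points X K. \<forall>U. openin X U \<and> c \<in> U \<longrightarrow> y \<in> U"
    using m by (auto simp: specialization_le_iff)
qed


section \<open>Sobriety and coherence of the Smyth power space\<close>

lemma irreducible_closed_inD:
  assumes C: "irreducible_closed_in Y C" and U: "openin Y U" "C \<inter> U \<noteq> {}" and V: "openin Y V" "C \<inter> V \<noteq> {}"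
  shows "C \<inter> (U \<inter> V) \<noteq> {}"
proof
  assume e: "C \<inter> (U \<inter> V) = {}"
  have Ct: "C \<subseteq> topspace Y"
    using C closedin_subset unfolding irreducible_closed_in_def by auto
  have "closedin Y (topspace Y - U)" "closedin Y (topspace Y - V)" using U V by auto
  moreover have "C \<subseteq> (topspace Y - U) \<union> (topspace Y - V)" using e Ct by auto
  ultimately have "C \<subseteq> topspace Y - U \<or> C \<subseteq> topspace Y - V"
    using C unfolding irreducible_closed_in_def by simp
  then show False using U(2) V(2) by auto
qed

lemma sober_smyth_power_space:
  assumes X: "well_filtered_space X" "intersection_continuous X" "coherent_space X"
  shows "sober_space (smyth_power_space X)"
  unfolding sober_space_def
proof (intro conjI allI impI t0_smyth_power_space)
  let ?P = "smyth_power_space X"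
  fix \<A> assume \<A>: "irreducible_closed_in ?P \<A>"
  then have cl: "closedin ?P \<A>" and ne: "\<A> \<noteq> {}" by (simp_all add: irreducible_closed_in_def)
  have AQ: "\<A> \<subseteq> Q_sets X" using closedin_subset[OF cl] by (simp add: topspace_smyth_power_space)
  \<comment> \<open>Closedness tested on boxes: a compact set whose open neighbourhoods all contain
    a member of \<open>\<A>\<close> is itself in \<open>\<A>\<close>.\<close>
  have memI: "K \<in> \<A>"
    if K: "K \<in> Q_sets X" and nb: "\<And>U. openin X U \<Longrightarrow> K \<subseteq> U \<Longrightarrow> \<exists>L\<in>\<A>. L \<subseteq> U" for K
  proof (rule ccontr)
    assume "K \<notin> \<A>"
    then have KK: "K \<in> Q_sets X - \<A>" using K by simp
    have "openin ?P (Q_sets X - \<A>)"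
      using cl by (simp add: closedin_def topspace_smyth_power_space)
    then obtain U where U: "openin X U" "K \<subseteq> U" "upper_box X U \<subseteq> Q_sets X - \<A>"
      using KK by (rule openin_smythE)
    obtain L where L: "L \<in> \<A>" "L \<subseteq> U" using nb[OF U(1,2)] by auto
    then have "L \<in> upper_box X U" using AQ by (auto simp: in_upper_box_iff)
    then show False using U(3) L(1) by auto
  qed
  \<comment> \<open>By irreducibility \<open>\<A>\<close> meets the boxes of \<open>U\<close> and
    \<open>V\<close> simultaneously, so it has members inside every open set around
    \<open>K \<inter> L\<close>. The empty open set excludes disjoint \<open>K\<close> and
    \<open>L\<close>.\<close>
  have inter: "K \<inter> L \<in> \<A>" if K: "K \<in> \<A>" and L: "L \<in> \<A>" for K L
  proof -
    have KL: "K \<in> Q_sets X" "L \<in> Q_sets X" using K L AQ by auto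
    have nb: "\<exists>M\<in>\<A>. M \<subseteq> W" if W: "openin X W" "K \<inter> L \<subseteq> W" for W
    proof -
      have "\<exists>U V. openin X U \<and> openin X V \<and> K \<subseteq> U \<and> L \<subseteq> V \<and> U \<inter> V \<subseteq> W"
        using X(2) KL W unfolding intersection_continuous_def by simp
      then obtain U V where UV: "openin X U" "openin X V" "K \<subseteq> U" "L \<subseteq> V" "U \<inter> V \<subseteq> W"
        by auto
      have "\<A> \<inter> upper_box X U \<noteq> {}" "\<A> \<inter> upper_box X V \<noteq> {}"
        using K L KL UV(3,4) by (auto simp: in_upper_box_iff)
      then have "\<A> \<inter> (upper_box X U \<inter> upper_box X V) \<noteq> {}"
        using irreducible_closed_inD[OF \<A>] openin_upper_box[OF UV(1)] openin_upper_box[OF UV(2)] by simp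
      then obtain M where "M \<in> \<A> \<inter> (upper_box X U \<inter> upper_box X V)" by (metis ex_in_conv)
      then have "M \<in> \<A>" "M \<subseteq> U \<inter> V" by (simp_all add: in_upper_box_iff)
      then show ?thesis using UV(5) by (meson order_trans)
    qed
    have "K \<inter> L \<noteq> {}"
    proof
      assume "K \<inter> L = {}"
      then obtain M where "M \<in> \<A>" "M \<subseteq> {}" using nb[of "{}"] by auto
      then show False using AQ Q_setsD(1)[of M X] by auto
    qed
    then show ?thesis using memI[OF Int_in_Q_sets[OF X(3) KL] nb] by simp
  qed
  have fil: "filtered_family \<A>"
    unfolding filtered_family_def using ne inter by (intro conjI ballI) auto
  have M: "\<Inter>\<A> \<in> Q_sets X" by (rule Inter_filtered_in_Q_sets[OF X(1) AQ fil])
  \<comment> \<open>Well-filteredness is exactly the neighbourhood condition of \<open>memI\<close>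
    for the filtered intersection.\<close>
  have MA: "\<Inter>\<A> \<in> \<A>"
    by (rule memI[OF M]) (rule well_filtered_Q_sets[OF X(1) AQ fil])
  have eq: "\<A> = ?P closure_of {\<Inter>\<A>}"
  proof (rule subset_antisym)
    show "?P closure_of {\<Inter>\<A>} \<subseteq> \<A>" using MA cl by (intro closure_of_minimal) auto
    show "\<A> \<subseteq> ?P closure_of {\<Inter>\<A>}"
    proof
      fix K assume "K \<in> \<A>"
      then show "K \<in> ?P closure_of {\<Inter>\<A>}"
        using AQ by (intro closure_of_singleton_smyth[OF M]) auto
    qed
  qed
  show "\<exists>!K. K \<in> topspace ?P \<and> \<A> = ?P closure_of {K}"
  proof (rule ex1I)
    show "\<Inter>\<A> \<in> topspace ?P \<and> \<A> = ?P closure_of {\<Inter>\<A>}"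
      using M eq by (simp add: topspace_smyth_power_space)
    fix K assume K: "K \<in> topspace ?P \<and> \<A> = ?P closure_of {K}"
    have "K \<in> \<A>" using K by (metis closure_of_subset empty_subsetI insert_subset)
    then have "specialization_le ?P K (\<Inter>\<A>)" using eq by (simp add: specialization_le_def)
    moreover have "specialization_le ?P (\<Inter>\<A>) K" using K MA by (simp add: specialization_le_def)
    moreover have "K \<in> topspace ?P" using K by simp
    moreover have "\<Inter>\<A> \<in> topspace ?P" using M by (simp add: topspace_smyth_power_space)
    ultimately show "K = \<Inter>\<A>"
      by (intro t0_specialization_antisym[OF t0_smyth_power_space])
  qed
qed

text \<open>Otherwise some open \<open>M\<close> containing \<open>U\<close> is maximal among those
  containing no member of the family. Its complement is irreducible because the family is filtered,
  and the generic point of the complement belongs to every member by saturation. That point lies in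
  \<open>U\<close>, hence in \<open>M\<close>, a contradiction.\<close>

lemma well_filtered_if_sober:
  assumes Y: "sober_space Y"
  shows "well_filtered_space Y"
  unfolding well_filtered_space_def
proof (intro conjI allI impI)
  show "t0_space Y" using Y by (simp add: sober_space_def)
  fix \<K> U assume "\<K> \<subseteq> Q_sets Y \<and> filtered_family \<K> \<and> openin Y U \<and> \<Inter>\<K> \<subseteq> U"
  then have K: "\<K> \<subseteq> Q_sets Y" "filtered_family \<K>" and U: "openin Y U" "\<Inter>\<K> \<subseteq> U" by simp_all
  show "\<exists>K\<in>\<K>. K \<subseteq> U"
  proof (rule ccontr)
    assume "\<not> ?thesis"
    then have neg: "\<not> S \<subseteq> U" if "S \<in> \<K>" for S using that by simp
    have chain: "\<exists>T\<in>\<K>. \<exists>C\<in>\<C>. T \<subseteq> C"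
      if C: "\<C> \<noteq> {}" "\<And>C. C \<in> \<C> \<Longrightarrow> openin Y C" "\<And>C D. C \<in> \<C> \<Longrightarrow> D \<in> \<C> \<Longrightarrow> C \<subseteq> D \<or> D \<subseteq> C"
        and S: "S \<in> \<K>" "S \<subseteq> \<Union>\<C>" for \<C> S
    proof -
      have SQ: "S \<in> Q_sets Y" using S(1) K(1) by auto
      have "\<exists>\<F>. finite \<F> \<and> \<F> \<subseteq> \<C> \<and> S \<subseteq> \<Union>\<F>"
        using Q_setsD(2)[OF SQ] C(2) S(2) unfolding compactin_def by simp
      then obtain \<F> where F: "finite \<F>" "\<F> \<subseteq> \<C>" "S \<subseteq> \<Union>\<F>" by auto
      have "\<F> \<noteq> {}" using F(3) Q_setsD(1)[OF SQ] by auto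
      moreover have "subset.chain UNIV \<F>" using C(3) F(2) by (auto simp: subset_chain_def)
      \<comment> \<open>A nonempty finite subchain contains its union, so a single member of the
        chain contains \<open>S\<close>.\<close>
      ultimately have "\<Union>\<F> \<in> \<F>" using F(1) by (intro Union_in_chain)
      then show ?thesis using F S(1) by auto
    qed
    have "\<exists>M. maximal_open_avoiding Y U (\<K>) M"
      by (rule maximal_open_exists[OF U(1)]) (fact neg, fact chain)
    then obtain M where MW: "maximal_open_avoiding Y U (\<K>) M" by (rule exE)
    have M: "openin Y M" "U \<subseteq> M" "\<And>S. S \<in> \<K> \<Longrightarrow> \<not> S \<subseteq> M"
      and max: "\<And>G. openin Y G \<Longrightarrow> \<not> G \<subseteq> M \<Longrightarrow> \<exists>S\<in>\<K>. S \<subseteq> M \<union> G"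
      using MW by (simp_all only: maximal_open_avoiding_def) auto
    have "irreducible_closed_in Y (topspace Y - M)"
      unfolding irreducible_closed_in_def
    proof (intro conjI allI impI)
      show "closedin Y (topspace Y - M)" using M(1) by auto
      obtain S where S: "S \<in> \<K>" using K(2) by (auto simp: filtered_family_def)
      then have "S \<subseteq> topspace Y" using K(1) Q_setsD(4) by auto
      then show "topspace Y - M \<noteq> {}" using M(3)[OF S] by auto
      fix A B assume AB: "closedin Y A \<and> closedin Y B \<and> topspace Y - M \<subseteq> A \<union> B"
      show "topspace Y - M \<subseteq> A \<or> topspace Y - M \<subseteq> B"
      proof (rule ccontr)
        assume "\<not> ?thesis"
        then have "\<not> topspace Y - A \<subseteq> M" "\<not> topspace Y - B \<subseteq> M" by auto
        moreover have "openin Y (topspace Y - A)" "openin Y (topspace Y - B)"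
          using AB by auto
        ultimately obtain S T where S: "S \<in> \<K>" "S \<subseteq> M \<union> (topspace Y - A)"
          and T: "T \<in> \<K>" "T \<subseteq> M \<union> (topspace Y - B)"
          using max by metis
        obtain R where R: "R \<in> \<K>" "R \<subseteq> S \<inter> T"
          using K(2) S(1) T(1) unfolding filtered_family_def by meson
        have "R \<subseteq> M"
        proof
          fix x assume "x \<in> R"
          then have "x \<in> S" "x \<in> T" using R(2) by auto
          then have "x \<in> M \<union> (topspace Y - A)" "x \<in> M \<union> (topspace Y - B)" using S(2) T(2) by auto
          moreover have "topspace Y - M \<subseteq> A \<union> B" using AB by simp
          ultimately show "x \<in> M" by auto
        qed
        then show False using M(3)[OF R(1)] by simp
      qed
    qed
    then obtain x where x: "x \<in> topspace Y" "topspace Y - M = Y closure_of {x}"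
      using Y unfolding sober_space_def by metis
    have "x \<in> S" if S: "S \<in> \<K>" for S
    proof -
      have SQ: "S \<in> Q_sets Y" using S K(1) by auto
      obtain y where y: "y \<in> S" "y \<notin> M" using M(3)[OF S] by auto
      then have "y \<in> Y closure_of {x}" using Q_setsD(4)[OF SQ] x(2) by auto
      then show ?thesis
        by (intro saturated_inD[OF Q_setsD(3)[OF SQ] y(1)]) (auto simp: in_closure_of)
    qed
    then have "x \<in> M" using U(2) M(2) by auto
    moreover have "x \<in> Y closure_of {x}" using x(1) by (simp add: in_closure_of)
    ultimately show False using x(2) by auto
  qed
qed

text \<open>The diagonal of \<open>\<K> \<times> \<L>\<close> recovers \<open>\<K> \<inter> \<L>\<close>, so a finite cover of the compact product
  by rectangles on which intersection stays inside the given cover suffices.\<close>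

lemma coherent_smyth_power_space:
  assumes X: "intersection_continuous X" "coherent_space X"
  shows "coherent_space (smyth_power_space X)"
  unfolding coherent_space_def
proof (intro conjI allI impI t0_smyth_power_space)
  let ?P = "smyth_power_space X"
  fix \<K> \<L> assume "compactin ?P \<K> \<and> saturated_in ?P \<K> \<and> compactin ?P \<L> \<and> saturated_in ?P \<L>"
  then have \<K>: "compactin ?P \<K>" "saturated_in ?P \<K>" and \<L>: "compactin ?P \<L>" "saturated_in ?P \<L>"
    by simp_all
  have KQ: "\<K> \<subseteq> Q_sets X" and LQ: "\<L> \<subseteq> Q_sets X"
    using compactin_subset_topspace[OF \<K>(1)] compactin_subset_topspace[OF \<L>(1)]
    by (simp_all add: topspace_smyth_power_space)
  \<comment> \<open>Open sets of the power space are stable under shrinking to smaller members of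
    \<open>Q_sets X\<close>, so saturated sets are too. This places a nonempty
    \<open>K \<inter> L\<close> in both families.\<close>
  have down: "M \<in> \<S>" if S: "saturated_in ?P \<S>" "K \<in> \<S>" and M: "M \<in> Q_sets X" "M \<subseteq> K" for \<S> K M
    using saturated_inD[OF S] openin_smyth_upward[OF _ _ M] by simp
  show "compactin ?P (\<K> \<inter> \<L>)"
    unfolding compactin_def
  proof (intro conjI allI impI)
    show "\<K> \<inter> \<L> \<subseteq> topspace ?P" using KQ by (auto simp: topspace_smyth_power_space)
    fix \<V> assume \<V>: "Ball \<V> (openin ?P) \<and> \<K> \<inter> \<L> \<subseteq> \<Union>\<V>"
    have "\<exists>A B \<F>. openin ?P A \<and> openin ?P B \<and> fst p \<in> A \<and> snd p \<in> B \<and>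
        finite \<F> \<and> \<F> \<subseteq> \<V> \<and> A \<inter> B \<subseteq> \<Union>\<F>" if "p \<in> \<K> \<times> \<L>" for p
    proof -
      from that obtain K L where p: "p = (K, L)" "K \<in> \<K>" "L \<in> \<L>" by auto
      have Q: "K \<in> Q_sets X" "L \<in> Q_sets X" using p KQ LQ by auto
      have "\<exists>W \<F>. openin X W \<and> K \<inter> L \<subseteq> W \<and> finite \<F> \<and> \<F> \<subseteq> \<V> \<and> upper_box X W \<subseteq> \<Union>\<F>"
      proof (cases "K \<inter> L = {}")
        case True
        \<comment> \<open>For disjoint \<open>K\<close> and \<open>L\<close> the empty open set has
          an empty box, covered by no members of \<open>\<V>\<close> at all.\<close>
        have "upper_box X {} = {}" using Q_setsD(1)[of "{}" X] by (auto simp: in_upper_box_iff)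
        then show ?thesis using True by (intro exI[of _ "{}"]) simp
      next
        case False
        have KL: "K \<inter> L \<in> Q_sets X" by (rule Int_in_Q_sets[OF X(2) Q False])
        have "K \<inter> L \<in> \<K> \<inter> \<L>"
          using down[OF \<K>(2) p(2) KL] down[OF \<L>(2) p(3) KL] by simp
        then obtain V where V: "V \<in> \<V>" "K \<inter> L \<in> V" using \<V> by auto
        have "openin ?P V" using V(1) \<V> by simp
        then obtain W where "openin X W" "K \<inter> L \<subseteq> W" "upper_box X W \<subseteq> V"
          using V(2) by (rule openin_smythE)
        then show ?thesis using V(1) by (intro exI[of _ W] exI[of _ "{V}"]) simp
      qed
      then obtain W \<F> where W: "openin X W" "K \<inter> L \<subseteq> W"
        and F: "finite \<F>" "\<F> \<subseteq> \<V>" "upper_box X W \<subseteq> \<Union>\<F>" by auto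
      have "\<exists>U V. openin X U \<and> openin X V \<and> K \<subseteq> U \<and> L \<subseteq> V \<and> U \<inter> V \<subseteq> W"
        using X(1) Q W unfolding intersection_continuous_def by simp
      then obtain U V where UV: "openin X U" "openin X V" "K \<subseteq> U" "L \<subseteq> V" "U \<inter> V \<subseteq> W" by auto
      have "upper_box X U \<inter> upper_box X V \<subseteq> upper_box X W"
      proof
        fix M assume "M \<in> upper_box X U \<inter> upper_box X V"
        then have "M \<in> Q_sets X" "M \<subseteq> U \<inter> V" by (simp_all add: in_upper_box_iff)
        then show "M \<in> upper_box X W"
          unfolding in_upper_box_iff using UV(5) by (meson order_trans)
      qed
      then have "upper_box X U \<inter> upper_box X V \<subseteq> \<Union>\<F>" using F(3) by (rule order_trans)
      then show ?thesis
        using F(1,2) UV Q p(1)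
        by (intro exI[of _ "upper_box X U"] exI[of _ "upper_box X V"] exI[of _ \<F>])
          (simp add: openin_upper_box in_upper_box_iff)
    qed
    then obtain A B F where ABF: "\<And>p. p \<in> \<K> \<times> \<L> \<Longrightarrow> openin ?P (A p) \<and> openin ?P (B p) \<and>
        fst p \<in> A p \<and> snd p \<in> B p \<and> finite (F p) \<and> F p \<subseteq> \<V> \<and> A p \<inter> B p \<subseteq> \<Union>(F p)"
      by metis
    have "compactin (prod_topology ?P ?P) (\<K> \<times> \<L>)"
      using \<K>(1) \<L>(1) by (simp add: compactin_Times)
    moreover have "\<And>D. D \<in> (\<lambda>p. A p \<times> B p) ` (\<K> \<times> \<L>) \<Longrightarrow> openin (prod_topology ?P ?P) D"
      using ABF by (auto simp: openin_prod_Times_iff)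
    moreover have "\<K> \<times> \<L> \<subseteq> \<Union>((\<lambda>p. A p \<times> B p) ` (\<K> \<times> \<L>))"
    proof
      fix p assume p: "p \<in> \<K> \<times> \<L>"
      then have "p \<in> A p \<times> B p" using ABF[OF p] by (simp add: mem_Times_iff)
      then show "p \<in> \<Union>((\<lambda>p. A p \<times> B p) ` (\<K> \<times> \<L>))" using p by (rule UN_I[rotated])
    qed
    ultimately have "\<exists>\<G>. finite \<G> \<and> \<G> \<subseteq> (\<lambda>p. A p \<times> B p) ` (\<K> \<times> \<L>) \<and> \<K> \<times> \<L> \<subseteq> \<Union>\<G>"
      unfolding compactin_def by simp
    then obtain \<G> where \<G>: "finite \<G>" "\<G> \<subseteq> (\<lambda>p. A p \<times> B p) ` (\<K> \<times> \<L>)" "\<K> \<times> \<L> \<subseteq> \<Union>\<G>"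
      by (elim exE conjE)
    obtain T where "T \<subseteq> \<K> \<times> \<L>" "finite T" "\<G> = (\<lambda>p. A p \<times> B p) ` T"
      using finite_subset_image[OF \<G>(1,2)] by (elim exE conjE)
    then have T: "finite T" "T \<subseteq> \<K> \<times> \<L>" "\<K> \<times> \<L> \<subseteq> \<Union>((\<lambda>p. A p \<times> B p) ` T)"
      using \<G>(3) by simp_all
    have "M \<in> \<Union>(\<Union>(F ` T))" if M: "M \<in> \<K> \<inter> \<L>" for M
    proof -
      have "(M, M) \<in> \<Union>((\<lambda>p. A p \<times> B p) ` T)" using M T(3) by auto
      then obtain p where p: "p \<in> T" "M \<in> A p \<inter> B p" by auto
      then have "M \<in> \<Union>(F p)" using ABF[of p] T(2) by auto
      then show ?thesis using p(1) by auto
    qed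
    then have "\<K> \<inter> \<L> \<subseteq> \<Union>(\<Union>(F ` T))" by (rule subsetI)
    moreover have "finite (\<Union>(F ` T))" using T ABF by (intro finite_UN_I) auto
    moreover have "\<Union>(F ` T) \<subseteq> \<V>" using T(2) ABF by (intro UN_least) auto
    ultimately show "\<exists>\<F>. finite \<F> \<and> \<F> \<subseteq> \<V> \<and> \<K> \<inter> \<L> \<subseteq> \<Union>\<F>" by (intro exI conjI)
  qed
qed


section \<open>Strong $R$-spaces\<close>

lemma coherent_finite_Inter:
  assumes Y: "coherent_space Y" and F: "finite \<F>" "\<F> \<noteq> {}" "\<F> \<subseteq> Q_sets Y"
  shows "compactin Y (\<Inter>\<F>) \<and> saturated_in Y (\<Inter>\<F>)"
  using F
proof (induction rule: finite_ne_induct)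
  case (singleton K)
  then show ?case using Q_setsD(2,3)[of K Y] by simp
next
  case (insert K \<F>)
  then have "compactin Y K \<and> saturated_in Y K" using Q_setsD(2,3)[of K Y] by simp
  then show ?case
    using insert Y saturated_in_Int[of Y K "\<Inter>\<F>"] unfolding coherent_space_def by simp
qed

text \<open>Finite intersections turn an arbitrary family into a filtered one with the same
  intersection. Coherence makes them compact and saturated, though possibly empty, and
  well-filteredness selects one of them.\<close>

lemma strong_R_if_coherent_well_filtered:
  assumes Y: "coherent_space Y" "well_filtered_space Y"
  shows "strong_R_space Y"
  unfolding strong_R_space_def
proof (intro conjI allI impI)
  show "t0_space Y" using Y(1) by (simp add: coherent_space_def)
  fix \<K> U assume "\<K> \<subseteq> Q_sets Y \<and> \<K> \<noteq> {} \<and> openin Y U \<and> \<Inter>\<K> \<subseteq> U"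
  then have K: "\<K> \<subseteq> Q_sets Y" "\<K> \<noteq> {}" and U: "openin Y U" "\<Inter>\<K> \<subseteq> U" by simp_all
  define \<G> where "\<G> = Inter ` {\<F>. finite \<F> \<and> \<F> \<noteq> {} \<and> \<F> \<subseteq> \<K>}"
  have "filtered_family \<G>"
    unfolding filtered_family_def
  proof (intro conjI ballI)
    obtain K where "K \<in> \<K>" using K(2) by auto
    then have "\<Inter>{K} \<in> \<G>" unfolding \<G>_def by (intro imageI) simp
    then show "\<G> \<noteq> {}" by auto
    fix A B assume "A \<in> \<G>" "B \<in> \<G>"
    then obtain \<F> \<F>' where "A = \<Inter>\<F>" "finite \<F>" "\<F> \<noteq> {}" "\<F> \<subseteq> \<K>"
      "B = \<Inter>\<F>'" "finite \<F>'" "\<F>' \<noteq> {}" "\<F>' \<subseteq> \<K>"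
      unfolding \<G>_def by auto
    then show "\<exists>C\<in>\<G>. C \<subseteq> A \<inter> B"
      unfolding \<G>_def by (intro bexI[of _ "\<Inter>(\<F> \<union> \<F>')"] imageI) auto
  qed
  moreover have "\<Inter>\<G> \<subseteq> U"
  proof -
    have "K \<in> \<G>" if "K \<in> \<K>" for K
    proof -
      have "\<Inter>{K} \<in> \<G>" unfolding \<G>_def using that by (intro imageI) simp
      then show ?thesis by simp
    qed
    then have "\<Inter>\<G> \<subseteq> \<Inter>\<K>" by (intro Inter_anti_mono) (rule subsetI)
    then show ?thesis using U(2) by (rule order_trans)
  qed
  moreover have "compactin Y G \<and> saturated_in Y G" if "G \<in> \<G>" for G
    using that coherent_finite_Inter[OF Y(1)] K(1) unfolding \<G>_def by auto
  ultimately have "\<exists>G\<in>\<G>. G \<subseteq> U"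
    using well_filtered_compact_saturated[OF Y(2) _ U(1), of \<G>] by simp
  then show "\<exists>\<F>. finite \<F> \<and> \<F> \<noteq> {} \<and> \<F> \<subseteq> \<K> \<and> \<Inter>\<F> \<subseteq> U"
    unfolding \<G>_def by auto
qed

lemma filtered_family_finite_lower:
  assumes "filtered_family \<K>" "finite \<F>" "\<F> \<subseteq> \<K>"
  shows "\<exists>K\<in>\<K>. \<forall>F\<in>\<F>. K \<subseteq> F"
  using assms(2,3)
proof (induction rule: finite_induct)
  case empty
  then show ?case using assms(1) by (auto simp: filtered_family_def)
next
  case (insert F \<F>)
  then obtain K where K: "K \<in> \<K>" "\<forall>F\<in>\<F>. K \<subseteq> F" by auto
  have "F \<in> \<K>" using insert.prems by simp
  then obtain K' where "K' \<in> \<K>" "K' \<subseteq> F \<inter> K"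
    using assms(1) K(1) unfolding filtered_family_def by meson
  then show ?case using K(2) by (intro bexI[of _ K']) auto
qed

text \<open>Adjoining \<open>K\<close> to the family gives a finite subfamily with intersection in
  \<open>U\<close>; filteredness replaces its members other than \<open>K\<close> by a single one
  below them all.\<close>

lemma strongly_well_filtered_if_strong_R:
  assumes Y: "strong_R_space Y"
  shows "strongly_well_filtered_space Y"
  unfolding strongly_well_filtered_space_def
proof (intro conjI allI impI)
  show "t0_space Y" using Y by (simp add: strong_R_space_def)
  fix \<K> K U
  assume a: "\<K> \<subseteq> Q_sets Y \<and> filtered_family \<K> \<and> K \<in> Q_sets Y \<and> openin Y U \<and> \<Inter>\<K> \<inter> K \<subseteq> U"
  have "insert K \<K> \<subseteq> Q_sets Y \<and> insert K \<K> \<noteq> {} \<and> openin Y U \<and> \<Inter>(insert K \<K>) \<subseteq> U"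
    using a by (simp add: Int_commute)
  then have "\<exists>\<F>. finite \<F> \<and> \<F> \<noteq> {} \<and> \<F> \<subseteq> insert K \<K> \<and> \<Inter>\<F> \<subseteq> U"
    using Y unfolding strong_R_space_def by meson
  then obtain \<F> where F: "finite \<F>" "\<F> \<subseteq> insert K \<K>" "\<Inter>\<F> \<subseteq> U" by auto
  \<comment> \<open>\<open>K\<close> is removed since it need not belong to \<open>\<K>\<close>. If
    nothing else remains, any member serves as \<open>K'\<close>.\<close>
  obtain K' where K': "K' \<in> \<K>" "\<forall>F\<in>\<F> - {K}. K' \<subseteq> F"
    using filtered_family_finite_lower[of \<K> "\<F> - {K}"] a F(1,2) by auto
  then have "K' \<inter> K \<subseteq> \<Inter>\<F>" by auto
  then show "\<exists>K'\<in>\<K>. K' \<inter> K \<subseteq> U" using K'(1) F(3) by (meson order_trans)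
qed

section \<open>Reduction of the six conditions and conclusion\<close>

lemma scott_boxed_and_intersection_continuous:
  assumes X: "well_filtered_space X" "coherent_space X"
    and cases: "locally_compact_T0 X \<or> (\<forall>K\<in>Q_sets X. countable_base_at X K)"
  shows "scott_boxed X \<and> intersection_continuous X"
  using cases
proof
  assume "locally_compact_T0 X"
  then show ?thesis
    by (intro conjI scott_boxed_if_locally_compact intersection_continuous_if_locally_compact[OF X])
next
  assume "\<forall>K\<in>Q_sets X. countable_base_at X K"
  then show ?thesis
    by (intro conjI scott_boxed_if_countable_base intersection_continuous_if_countable_base[OF X]) simp_all
qed

lemma countable_base_at_countable_compact:
  assumes X: "first_countable X" and K: "compactin X K" "countable K"
  shows "countable_base_at X K"
  by (rule countable_base_at_countable_generators[OF X K order_refl]) auto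

theorem proposition6p9:
  fixes X :: "'a topology"
  assumes "t0_space X" and "coherent_space X"
    and "((core_compact_space X \<or> locally_compact_T0 X) \<and> well_filtered_space X)
       \<or> (second_countable X \<and> well_filtered_space X)
       \<or> (well_filtered_space X \<and> first_countable (smyth_power_space X))
       \<or> (first_countable X \<and> well_filtered_space X \<and> (\<forall>K\<in>Q_sets X. countable (minimal_points X K)))
       \<or> (first_countable X \<and> well_filtered_space X \<and> (\<forall>K. compactin X K \<longrightarrow> countable K))
       \<or> (countable (topspace X) \<and> first_countable X \<and> well_filtered_space X)"
  shows "smyth_power_space X = scott_power_space X
       \<and> sober_space (smyth_power_space X)
       \<and> strong_R_space (smyth_power_space X)
       \<and> strongly_well_filtered_space (smyth_power_space X)"
proof -
  have wf: "well_filtered_space X" using assms(3) by (elim disjE) simp_all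
  \<comment> \<open>The first condition leads to local compactness; each of the other five leads to
    countable bases at compact saturated sets.\<close>
  have "locally_compact_T0 X \<or> (\<forall>K\<in>Q_sets X. countable_base_at X K)"
    using assms(3)
  proof (elim disjE conjE)
    assume "core_compact_space X"
    then show ?thesis using locally_compact_if_core_compact[OF _ wf] by simp
  next
    assume "second_countable X"
    then show ?thesis by (intro disjI2 ballI countable_base_at_second_countable Q_setsD(2))
  next
    assume "first_countable (smyth_power_space X)"
    then show ?thesis by (intro disjI2 ballI countable_base_at_first_countable_smyth)
  next
    assume "first_countable X" "\<forall>K\<in>Q_sets X. countable (minimal_points X K)"
    then show ?thesis
      by (intro disjI2 ballI countable_base_at_minimal_points[OF assms(1)] Q_setsD(2)) simp_all
  next
    assume "first_countable X" "\<forall>K. compactin X K \<longrightarrow> countable K"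
    then show ?thesis by (intro disjI2 ballI countable_base_at_countable_compact) (simp_all add: Q_setsD(2))
  next
    assume "first_countable X" "countable (topspace X)"
    then show ?thesis
      by (intro disjI2 ballI countable_base_at_countable_compact Q_setsD(2))
        (auto intro: countable_subset[OF Q_setsD(4)])
  qed simp
  then have bc: "scott_boxed X" "intersection_continuous X"
    using scott_boxed_and_intersection_continuous[OF wf assms(2)] by simp_all
  have sober: "sober_space (smyth_power_space X)"
    by (rule sober_smyth_power_space[OF wf bc(2) assms(2)])
  have strong_R: "strong_R_space (smyth_power_space X)"
    by (intro strong_R_if_coherent_well_filtered coherent_smyth_power_space[OF bc(2) assms(2)]
        well_filtered_if_sober sober)
  show ?thesis
    by (intro conjI smyth_eq_scott_power_space[OF wf bc(1)] sober strong_R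
        strongly_well_filtered_if_strong_R[OF strong_R])
qed

end
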